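(* Let $a>0$ and let $n\ge1$ be a fixed odd integer. There are constants $C,\Lambda>0$ depending only on $a$ and $n$ such that for every $\lambda\ge\Lambda$ with $1\le n<n_\lambda$ and all $t>0$, $$\|E_n(\cdot,t)\|_{L^2}\le C\,\lambda^{-1/4}.$$
   Context: Fix $a>0$, write $\chi_a=\chi_{[-a,a]}$; for $\lambda>0$ let $V_\lambda=\lambda\chi_a$ and $H_\lambda=-\frac12\frac{d^2}{dx^2}+V_\lambda$ on $L^2(\mathbb R)$. Square roots and logarithms are principal branches. For $k$ write $\tilde k=\sqrt{k^2-2\lambda}$ and $F(k)=\cos\tilde ka-i\frac{\tilde k}{k}\sin\tilde ka$ (even in $\tilde k$, hence meromorphic in $k$); for $k>0$ let $\bar F(k)=\cos\tilde ka+i\frac{\tilde k}{k}\sin\tilde ka$. Symmetric generalized eigenfunctions of $H_\lambda$: for $|x|\le a$, $\phi(k,x)=\frac{e^{-ika}}{\sqrt\pi\,F(k)}\cos(\tilde kx)$, and for $|x|>a$, $\phi(k,x)=\frac{e^{-ika}}{\sqrt{4\pi}}\left(e^{-ik(|x|-a)}+\frac{\bar F(k)}{F(k)}e^{ik(|x|-a)}\right)$. Resonances: for an integer $n\ge1$, $z_n$ is the complex number with $\operatorname{Re}z_n>0$, $\operatorname{Im}z_n<0$ such that, with $\tilde z_n=\sqrt{z_n^2-2\lambda}$, the number $\tilde\kappa=\tilde z_n/\sqrt{2\lambda}$ satisfies $\tilde\kappa=\frac{n\pi}{2a\sqrt{2\lambda}}-\frac{i}{a\sqrt{2\lambda}}\ln(\tilde\kappa+\sqrt{\tilde\kappa^2+1})$.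 For odd $n$, $F$ has a simple zero at $z_n$. For odd $n$ the Gamow function satisfies $G_n(x)=\cos(\tilde z_nx)$ for $|x|\le a$. For odd $n$: - $\psi_n(x)=\cos\!\left(\frac{n\pi x}{2a}\right)\chi_a(x)$; - $\hat\psi_n(k)=\int_{\mathbb R}\psi_n(x)\overline{\phi(k,x)}\,dx$ for $k>0$; - $\eta_n(k)=e^{-ika}\frac{a_{-1}}{k-z_n}$ with $a_{-1}=\operatorname{Res}_{k=z_n}\frac{1}{\sqrt\pi F(k)}$; - $E_n(x,t)=\chi_a(x)\int_0^\infty\hat\psi_n(k)\left(\phi(k,x)-\eta_n(k)G_n(x)\right)e^{-i\frac{k^2}{2}t}\,dk$. ($E_n(\cdot,t)$ is the error when $\phi(k,\cdot)$ is replaced by $\eta_n(k)G_n$ in the eigenfunction expansion of $\chi_ae^{-iH_\lambda t}\psi_n$.) Finally $n_\lambda=\sqrt{\lambda/2-\sqrt{2\lambda}}$. *)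

theory Defs
  imports "HOL-Complex_Analysis.Complex_Analysis"
begin

definition ktilde :: "real \<Rightarrow> complex \<Rightarrow> complex" where
  "ktilde lam k = csqrt (k\<^sup>2 - 2 * of_real lam)"

definition F :: "real \<Rightarrow> real \<Rightarrow> complex \<Rightarrow> complex" where
  "F a lam k = cos (ktilde lam k * of_real a)
     - \<i> * (ktilde lam k / k) * sin (ktilde lam k * of_real a)"

definition F_bar :: "real \<Rightarrow> real \<Rightarrow> real \<Rightarrow> complex" where
  "F_bar a lam k = cos (ktilde lam (of_real k) * of_real a)
     + \<i> * (ktilde lam (of_real k) / of_real k) * sin (ktilde lam (of_real k) * of_real a)"

definition phi :: "real \<Rightarrow> real \<Rightarrow> real \<Rightarrow> real \<Rightarrow> complex" where
  "phi a lam k x =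
     (if \<bar>x\<bar> \<le> a
      then exp (- \<i> * of_real (k * a)) / (of_real (sqrt pi) * F a lam (of_real k))
             * cos (ktilde lam (of_real k) * of_real x)
      else exp (- \<i> * of_real (k * a)) / of_real (sqrt (4 * pi))
             * (exp (- \<i> * of_real (k * (\<bar>x\<bar> - a)))
                + F_bar a lam k / F a lam (of_real k) * exp (\<i> * of_real (k * (\<bar>x\<bar> - a)))))"

definition is_resonance :: "real \<Rightarrow> real \<Rightarrow> nat \<Rightarrow> complex \<Rightarrow> bool" where
  "is_resonance a lam n z \<longleftrightarrow>
     Re z > 0 \<and> Im z < 0 \<and>
     (let \<kappa> = ktilde lam z / of_real (sqrt (2 * lam)) in
        \<kappa> = of_real (real n * pi / (2 * a * sqrt (2 * lam)))
            - \<i> / of_real (a * sqrt (2 * lam)) * Ln (\<kappa> + csqrt (\<kappa>\<^sup>2 + 1)))"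

definition resonance :: "real \<Rightarrow> real \<Rightarrow> nat \<Rightarrow> complex" where
  "resonance a lam n = (THE z. is_resonance a lam n z)"

text \<open>The Gamow function is needed, and given by this formula, only for \<open>\<bar>x\<bar> \<le> a\<close> and odd \<open>n\<close>.\<close>

definition gamow :: "real \<Rightarrow> real \<Rightarrow> nat \<Rightarrow> real \<Rightarrow> complex" where
  "gamow a lam n x = cos (ktilde lam (resonance a lam n) * of_real x)"

definition psi :: "real \<Rightarrow> nat \<Rightarrow> real \<Rightarrow> real" where
  "psi a n x = cos (real n * pi * x / (2 * a)) * indicator {-a..a} x"

definition psi_hat :: "real \<Rightarrow> real \<Rightarrow> nat \<Rightarrow> real \<Rightarrow> complex" where
  "psi_hat a lam n k = (LBINT x. of_real (psi a n x) * cnj (phi a lam k x))"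

definition eta :: "real \<Rightarrow> real \<Rightarrow> nat \<Rightarrow> real \<Rightarrow> complex" where
  "eta a lam n k =
     exp (- \<i> * of_real (k * a))
       * (residue (\<lambda>w. 1 / (of_real (sqrt pi) * F a lam w)) (resonance a lam n)
          / (of_real k - resonance a lam n))"

definition E :: "real \<Rightarrow> real \<Rightarrow> nat \<Rightarrow> real \<Rightarrow> real \<Rightarrow> complex" where
  "E a lam n x t =
     indicator {-a..a} x *
     (LBINT k:{0<..}. psi_hat a lam n k * (phi a lam k x - eta a lam n k * gamow a lam n x)
                        * exp (- \<i> * of_real (k\<^sup>2 / 2 * t)))"

definition n_max :: "real \<Rightarrow> real" where
  "n_max lam = sqrt (lam / 2 - sqrt (2 * lam))"

text \<open>Since a Bochner integral is 0 on non-integrable functions, bounds on \<open>L2_norm f\<close>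
  are meaningful only together with \<open>in_L2 f\<close>.\<close>

definition in_L2 :: "(real \<Rightarrow> complex) \<Rightarrow> bool" where
  "in_L2 f \<longleftrightarrow> f \<in> borel_measurable lborel \<and> integrable lborel (\<lambda>x. (cmod (f x))\<^sup>2)"

definition L2_norm :: "(real \<Rightarrow> complex) \<Rightarrow> real" where
  "L2_norm f = sqrt (LBINT x. (cmod (f x))\<^sup>2)"

end

theory Submission
  imports Defs
begin

text \<open>
  With \<open>q = sqrt (2 * lam)\<close>, the integral over \<open>k\<close> is bounded absolutely, uniformly in
  \<open>\<bar>x\<bar> \<le> a\<close> and \<open>t\<close>, by a multiple of \<open>1 / sqrt q\<close>. Writing the resonance equation through
  \<open>Arcsin\<close> makes it a contraction, so the wave number \<open>zeta\<close> of the Gamow function lies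
  within \<open>O(1/q)\<close> of \<open>nu = n * pi / (2 * a)\<close>. Below the barrier (\<open>k \<le> q\<close>) the overlap with
  \<open>psi\<close> alone gives \<open>O(log q / q)\<close>. Above it, let \<open>w = sqrt (k\<^sup>2 - q\<^sup>2)\<close>, so that
  \<open>(k * \<bar>F\<bar>)\<^sup>2 = w\<^sup>2 + q\<^sup>2 * (cos (w * a))\<^sup>2\<close>. On each period of the cosine the eigenfunction has one
  sharp peak; the peak with \<open>w\<close> near \<open>nu\<close> is cancelled by the pole term up to a bounded
  remainder, while the other peaks are damped by the quadratic decay of the overlap in
  \<open>w\<close>. Measured in \<open>dk = (w / k) dw\<close>, the \<open>m\<close>-th period contributes
  \<open>O((m + 1) powr (-3/2) / sqrt q)\<close>.
\<close>

subsection \<open>Trigonometric estimates\<close>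

text \<open>At the resonant peak \<open>\<bar>F\<bar>\<close> is only of order
  \<open>nu / q\<close>, and both factors of the integrand carry \<open>1 / F\<close>. Without the
  subtraction of the pole term, \<open>(w / k) / \<bar>F\<bar>\<^sup>2\<close> behaves there like a
  Lorentzian in \<open>w\<close> of width and numerator of order \<open>1 / q\<close>; its integral
  stays of order one, so no decay could come out. Hence one of the two factors \<open>1 / F\<close>
  has to be removed everywhere. Near the resonance the subtraction of the pole does this; elsewhere
  it happens inside the overlap, whose factor \<open>cos (w * a)\<close> is dominated by
  \<open>F\<close>. What remains is a single \<open>1 / \<bar>F\<bar>\<close> times the Jacobian.
  This is at most 1, and small at a distance from the peak; balancing the two at a distance of order
  \<open>1 / sqrt q\<close> produces the exponent -1/4 of \<open>lam\<close>.

  A second obstacle is that \<open>resonance\<close> is a definite description over the whole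
  complex plane. A fixed point near \<open>nu\<close> is therefore not enough: its uniqueness has to
  be global.\<close>

lemma norm_exp_i_strip:
  assumes "\<bar>Im z\<bar> \<le> 1"
  shows "cmod (exp (\<i> * z)) + cmod (exp (- (\<i> * z))) \<le> 4"
proof -
  have *: "exp x + exp (- x) \<le> 4" if "0 \<le> x" "x \<le> 1" for x :: real
  proof -
    have "exp x \<le> 3" using exp_le that by (smt (verit) exp_le_cancel_iff)
    moreover have "exp (- x) \<le> 1" using that by simp
    ultimately show ?thesis by linarith
  qed
  show ?thesis
    using *[of "Im z"] *[of "- Im z"] assms by (cases "Im z \<ge> 0") (auto simp: norm_exp_eq_Re)
qed

lemma norm_cos_strip: "\<bar>Im z\<bar> \<le> 1 \<Longrightarrow> cmod (cos z) \<le> 2"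
  using norm_exp_i_strip[of z] norm_triangle_ineq[of "exp (\<i> * z)" "exp (- (\<i> * z))"]
  by (simp add: cos_exp_eq norm_divide)

lemma norm_sin_strip: "\<bar>Im z\<bar> \<le> 1 \<Longrightarrow> cmod (sin z) \<le> 2"
  using norm_exp_i_strip[of z] norm_triangle_ineq4[of "exp (\<i> * z)" "exp (- (\<i> * z))"]
  by (simp add: sin_exp_eq norm_divide norm_mult)

lemma convex_strip: "convex {z. \<bar>Im z\<bar> \<le> 1}"
proof -
  have "{z. \<bar>Im z\<bar> \<le> 1} = {z. Im z \<le> 1} \<inter> {z. Im z \<ge> -1}" by auto
  then show ?thesis by (simp add: convex_Int convex_halfspace_Im_ge convex_halfspace_Im_le)
qed

lemma norm_sin_diff_strip:
  assumes "\<bar>Im u\<bar> \<le> 1" "\<bar>Im v\<bar> \<le> 1"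
  shows "cmod (sin u - sin v) \<le> 2 * cmod (u - v)"
  by (rule field_differentiable_bound[OF convex_strip, of sin cos])
     (use assms norm_cos_strip in \<open>auto intro!: derivative_eq_intros\<close>)

lemma norm_cos_diff_strip:
  assumes "\<bar>Im u\<bar> \<le> 1" "\<bar>Im v\<bar> \<le> 1"
  shows "cmod (cos u - cos v) \<le> 2 * cmod (u - v)"
  by (rule field_differentiable_bound[OF convex_strip, of cos "\<lambda>z. - sin z"])
     (use assms norm_sin_strip in \<open>auto intro!: derivative_eq_intros\<close>)

text \<open>Mean value estimate for \<open>cos z + sin v * z\<close>, whose derivative
  \<open>sin v - sin z\<close> vanishes at \<open>v\<close>. Intersecting the strip with a disc
  around \<open>v\<close> keeps the domain convex and bounds this derivative by
  \<open>2 * cmod (u - v)\<close>.\<close>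

lemma norm_cos_taylor_strip:
  assumes "\<bar>Im u\<bar> \<le> 1" "\<bar>Im v\<bar> \<le> 1"
  shows "cmod (cos u - cos v + sin v * (u - v)) \<le> 2 * (cmod (u - v))\<^sup>2"
proof -
  let ?S = "{z. \<bar>Im z\<bar> \<le> 1} \<inter> cball v (cmod (u - v))"
  have "cmod ((cos u + sin v * u) - (cos v + sin v * v)) \<le> (2 * cmod (u - v)) * cmod (u - v)"
  proof (rule field_differentiable_bound[of ?S _ "\<lambda>z. sin v - sin z"])
    show "convex ?S" by (intro convex_Int convex_strip convex_cball)
    show "((\<lambda>z. cos z + sin v * z) has_field_derivative sin v - sin z) (at z within ?S)" for z
      by (auto intro!: derivative_eq_intros)
    show "cmod (sin v - sin z) \<le> 2 * cmod (u - v)" if "z \<in> ?S" for z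
      using norm_sin_diff_strip[of v z] that assms by (auto simp: dist_norm)
  qed (use assms in \<open>auto simp: dist_norm norm_minus_commute\<close>)
  then show ?thesis by (simp add: algebra_simps power2_eq_square)
qed

text \<open>The square of \<open>cmod (sin z)\<close> is
  \<open>(sin (Re z))\<^sup>2 + (sinh (Im z))\<^sup>2\<close>, and \<open>sinh\<close> dominates its
  argument. With \<open>z = Arcsin u\<close> this controls the imaginary part of
  \<open>Arcsin u\<close> by \<open>cmod u\<close> for every \<open>u\<close>.\<close>

lemma abs_Im_le_norm_sin: "\<bar>Im z\<bar> \<le> cmod (sin z)"
proof -
  have "\<bar>Im z\<bar> \<le> \<bar>(exp (Im z) - inverse (exp (Im z))) / 2\<bar>"
    by (rule real_le_abs_sinh)
  then have "(Im z)\<^sup>2 \<le> ((exp (Im z) - inverse (exp (Im z))) / 2)\<^sup>2"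
    by (simp only: abs_le_square_iff)
  also have "\<dots> = (exp (2 * Im z) + inverse (exp (2 * Im z)) - 2) / 4"
    unfolding exp_double power_divide power2_diff
    by (simp add: power_inverse)
  also have "\<dots> \<le> (cmod (sin z))\<^sup>2"
    unfolding norm_sin_squared using cos_le_one[of "2 * Re z"] by (simp add: divide_right_mono)
  finally show ?thesis by (simp flip: abs_le_square_iff)
qed

text \<open>The derivative is \<open>1 / cos (Arcsin z)\<close>, and
  \<open>(cos (Arcsin z))\<^sup>2 = 1 - z\<^sup>2\<close> stays away from 0 on the disc of radius
  1/2.\<close>

lemma norm_Arcsin_diff:
  assumes "cmod u \<le> 1/2" "cmod v \<le> 1/2"
  shows "cmod (Arcsin u - Arcsin v) \<le> 2 * cmod (u - v)"
proof (rule field_differentiable_bound[of "cball 0 (1/2)" Arcsin "\<lambda>z. inverse (cos (Arcsin z))"])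
  fix z :: complex assume "z \<in> cball 0 (1/2)"
  then have z: "cmod z \<le> 1/2" by simp
  then have "\<bar>Re z\<bar> < 1" using abs_Re_le_cmod[of z] by linarith
  then show "(Arcsin has_field_derivative inverse (cos (Arcsin z))) (at z within cball 0 (1/2))"
    by (rule has_field_derivative_at_within[OF has_field_derivative_Arcsin])
  have "1 \<le> cmod (1 - z\<^sup>2) + cmod (z\<^sup>2)"
    using norm_triangle_ineq[of "1 - z\<^sup>2" "z\<^sup>2"] by simp
  moreover have "cmod (z\<^sup>2) \<le> (1/2)\<^sup>2" unfolding norm_power using z by (intro power_mono) auto
  ultimately have "cmod (1 - z\<^sup>2) \<ge> 1/4" by (simp add: power2_eq_square)
  moreover have "(cos (Arcsin z))\<^sup>2 = 1 - z\<^sup>2" by (simp add: cos_squared_eq)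
  ultimately have "(cmod (cos (Arcsin z)))\<^sup>2 \<ge> (1/2)\<^sup>2"
    by (simp add: power2_eq_square flip: norm_mult)
  then have "cmod (cos (Arcsin z)) \<ge> 1/2" by (rule power2_le_imp_le) simp
  then show "cmod (inverse (cos (Arcsin z))) \<le> 2"
    using le_imp_inverse_le[of "1/2" "cmod (cos (Arcsin z))"] by (simp add: norm_inverse)
qed (use assms in auto)

text \<open>Jordan's inequality with 1/2 in place of \<open>2 / pi\<close>. For
  \<open>0 \<le> t \<le> pi / 2\<close> one has \<open>t / 2 \<le> tan (t / 2)\<close>, and
  \<open>tan (t / 2) \<le> sin t\<close> because
  \<open>2 * (cos (t / 2))\<^sup>2 \<ge> 1\<close>.\<close>

lemma half_abs_le_abs_sin:
  fixes t :: real
  assumes "\<bar>t\<bar> \<le> pi / 2"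
  shows "\<bar>t\<bar> / 2 \<le> \<bar>sin t\<bar>"
proof -
  have *: "t / 2 \<le> sin t" if "0 \<le> t" "t \<le> pi / 2" for t :: real
  proof -
    have "cos (pi / 4) \<le> cos (t / 2)" using that by (intro cos_monotone_0_pi_le) auto
    then have c: "sqrt 2 / 2 \<le> cos (t / 2)" by (simp add: cos_45)
    then have "(sqrt 2 / 2)\<^sup>2 \<le> (cos (t / 2))\<^sup>2" by (intro power_mono) auto
    then have c2: "1 / 2 \<le> (cos (t / 2))\<^sup>2" by (simp add: power_divide)
    have c0: "0 < cos (t / 2)" using c by (rule less_le_trans[rotated]) simp
    have s0: "0 \<le> sin (t / 2)" using that pi_gt_zero by (intro sin_ge_zero) linarith+
    have "t / 2 = arctan (tan (t / 2))" using that pi_gt_zero by (intro arctan_tan[symmetric]) linarith+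
    also have "\<dots> \<le> tan (t / 2)" using s0 c0 by (intro arctan_le_self) (simp add: tan_def)
    also have "\<dots> \<le> tan (t / 2) * (2 * (cos (t / 2))\<^sup>2)"
      using s0 c0 c2 mult_left_mono[of 1 "2 * (cos (t / 2))\<^sup>2" "tan (t / 2)"] by (simp add: tan_def)
    also have "\<dots> = sin (2 * (t / 2))"
      unfolding sin_double using c0 by (simp add: tan_def power2_eq_square)
    finally show ?thesis by simp
  qed
  show ?thesis using *[of t] *[of "- t"] assms by (cases "0 \<le> t") auto
qed

subsection \<open>Measurability\<close>

lemma borel_measurable_continuous_compose:
  assumes "f \<in> borel_measurable M" "continuous_on UNIV g"
  shows "(\<lambda>x. g (f x)) \<in> borel_measurable M"
  using borel_measurable_continuous_onI[OF assms(2)] assms(1) by (rule measurable_compose_rev)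

lemma complex_functions_measurable [measurable]:
  fixes f :: "'a \<Rightarrow> complex"
  assumes [measurable]: "f \<in> borel_measurable M"
  shows "(\<lambda>x. cos (f x)) \<in> borel_measurable M" "(\<lambda>x. sin (f x)) \<in> borel_measurable M"
    "(\<lambda>x. cnj (f x)) \<in> borel_measurable M"
  by (rule borel_measurable_continuous_compose[OF assms], intro continuous_intros)+

lemma ktilde_measurable [measurable]:
  assumes [measurable]: "f \<in> borel_measurable M"
  shows "(\<lambda>x. ktilde lam (of_real (f x))) \<in> borel_measurable M"
proof -
  have "ktilde lam (of_real k) =
      of_real (sqrt \<bar>k\<^sup>2 - 2 * lam\<bar>) * (if k\<^sup>2 - 2 * lam \<ge> 0 then 1 else \<i>)" for k
    using csqrt_of_real'[of "k\<^sup>2 - 2 * lam"] by (simp add: ktilde_def)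
  then show ?thesis by simp
qed

lemma phi_measurable [measurable]:
  assumes [measurable]: "f \<in> borel_measurable M" "g \<in> borel_measurable M"
  shows "(\<lambda>x. phi a lam (f x) (g x)) \<in> borel_measurable M"
  unfolding phi_def F_def F_bar_def by measurable

lemma psi_hat_measurable [measurable]: "psi_hat a lam n \<in> borel_measurable borel"
  unfolding psi_hat_def[abs_def] psi_def by measurable

lemma eta_measurable [measurable]: "eta a lam n \<in> borel_measurable borel"
  unfolding eta_def[abs_def] by measurable

lemma gamow_measurable [measurable]: "gamow a lam n \<in> borel_measurable borel"
  unfolding gamow_def[abs_def] by measurable

lemma E_measurable: "(\<lambda>x. E a lam n x t) \<in> borel_measurable borel"
  unfolding E_def set_lebesgue_integral_def by measurable

subsection \<open>Location of the resonance\<close>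

text \<open>Both bounds on \<open>sqrt (2 * lam)\<close> hold for all large \<open>lam\<close> once
  \<open>a\<close> and \<open>n\<close> are fixed. The factor 1000 is a generous margin: together
  with \<open>1 \<le> nu * a\<close> it yields \<open>1000 \<le> a * q\<close> and keeps
  \<open>zeta\<close> within 1.2 percent of \<open>nu\<close>.\<close>

locale barrier =
  fixes a :: real and n :: nat and lam :: real
  assumes a_pos: "0 < a" and odd_n: "odd n" and q_ge_1: "1 \<le> sqrt (2 * lam)"
    and q_ge_nu: "1000 * (real n * pi / (2 * a)) \<le> sqrt (2 * lam)"
begin

definition q :: real where "q = sqrt (2 * lam)"
definition nu :: real where "nu = real n * pi / (2 * a)"
definition sg :: real where "sg = sin (nu * a)"

lemma lam_pos: "lam > 0"
proof -
  have "sqrt (2 * lam) > 0" using q_ge_1 by linarith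
  then show ?thesis by simp
qed

lemma q_ge: "1 \<le> q" "1000 * nu \<le> q" and q_pos: "0 < q"
  using q_ge_1 q_ge_nu by (auto simp: q_def nu_def)

lemma n_ge_1: "1 \<le> real n"
  using odd_n by (cases n) auto

lemma nu_pos: "0 < nu" and nu_a: "nu * a = real n * pi / 2" and nu_a_ge: "1 \<le> nu * a"
proof -
  show "nu * a = real n * pi / 2" using a_pos by (simp add: nu_def)
  moreover have "2 \<le> real n * pi" using mult_mono[of 1 "real n" 2 pi] n_ge_1 pi_ge_two by simp
  ultimately show "1 \<le> nu * a" by simp
  show "0 < nu" using n_ge_1 a_pos by (simp add: nu_def)
qed

lemma pi_a_le: "pi / a \<le> 2 * nu"
  using n_ge_1 a_pos by (simp add: nu_def field_simps)

lemma inverse_a_le: "1 / a \<le> nu"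
  using nu_a_ge a_pos by (simp add: field_simps)

lemma aq_ge: "1000 \<le> a * q"
proof -
  have "1000 * 1 \<le> 1000 * (nu * a)" using nu_a_ge by simp
  also have "\<dots> \<le> a * q" using mult_left_mono[OF q_ge(2), of a] a_pos by (simp add: mult_ac)
  finally show ?thesis by simp
qed

lemma cos_nu_a: "cos (nu * a) = 0"
proof -
  obtain m where m: "n = Suc (2 * m)" using odd_n by (auto elim: oddE)
  have "real n * pi / 2 = real m * pi + pi / 2" by (simp add: m field_simps)
  then have "nu * a = real m * pi + pi / 2" by (simp only: nu_a)
  then show ?thesis by (simp add: cos_add)
qed

lemma abs_sg: "\<bar>sg\<bar> = 1"
proof -
  have "sg\<^sup>2 = 1" using sin_cos_squared_add[of "nu * a"] cos_nu_a by (simp add: sg_def)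
  then show ?thesis by (auto simp: power2_eq_1_iff)
qed

lemma q_sq: "q\<^sup>2 = 2 * lam"
  using lam_pos by (simp add: q_def)

lemma ktilde_sq: "(ktilde lam k)\<^sup>2 = k\<^sup>2 - of_real (q\<^sup>2)"
  by (simp add: ktilde_def q_sq)

text \<open>\<open>Arcsin u\<close> is
  \<open>- \<i> * Ln (\<i> * u + csqrt (1 - u\<^sup>2))\<close>; at \<open>u = - \<i> * x\<close>
  this is the logarithm of the definition. Multiplying the equation by \<open>q\<close> undoes the
  normalisation of \<open>ktilde\<close>.\<close>

lemma is_resonance_iff:
  "is_resonance a lam n w \<longleftrightarrow> Re w > 0 \<and> Im w < 0 \<and>
     ktilde lam w = of_real nu + Arcsin (- \<i> * (ktilde lam w / of_real q)) / of_real a"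
proof -
  define x where "x = ktilde lam w / of_real q"
  have "Arcsin (- \<i> * x) = - \<i> * Ln (x + csqrt (x\<^sup>2 + 1))"
    by (simp add: Arcsin_def power_mult_distrib add.commute)
  then have "of_real (real n * pi / (2 * a * q)) - \<i> / of_real (a * q) * Ln (x + csqrt (x\<^sup>2 + 1))
      = (of_real nu + Arcsin (- \<i> * x) / of_real a) / of_real q"
    using a_pos q_pos by (simp add: nu_def field_simps)
  moreover have "x = y / of_real q \<longleftrightarrow> ktilde lam w = y" for y
    using q_pos by (simp add: x_def)
  ultimately show ?thesis
    unfolding is_resonance_def Let_def x_def q_def by simp
qed

text \<open>One side of the resonance equation for \<open>ktilde\<close>: \<open>-\<i> * Ln (w + csqrt (w\<^sup>2 + 1))\<close> is \<open>Arcsin (-\<i> * w)\<close>.\<close>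

definition step :: "complex \<Rightarrow> complex" where
  "step w = of_real nu + Arcsin (- \<i> * (w / of_real q)) / of_real a"

section \<open>Existence, uniqueness and size of the fixed point\<close>

definition zeta :: complex where "zeta = (THE w. step w = w)"

text \<open>This a priori bound is what makes uniqueness global, since the contraction estimate is
  available only on a ball. The principal \<open>Arcsin\<close> has real part at most
  \<open>pi\<close> in modulus and imaginary part at most \<open>cmod w / q\<close>. As
  \<open>pi / a \<le> 2 * nu\<close>, the norm of \<open>w\<close> is at most \<open>3 * nu\<close>
  plus a thousandth of itself; 6 is rounded up.\<close>

lemma step_fixpoint_bound:
  assumes "step w = w"
  shows "cmod w \<le> 6 * nu"
proof -
  define v where "v = Arcsin (- \<i> * (w / of_real q))"
  have w: "w = of_real nu + v / of_real a" using assms by (simp add: step_def v_def)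
  have "sin v = - \<i> * (w / of_real q)" by (simp add: v_def)
  then have "\<bar>Im v\<bar> \<le> cmod w / q"
    using abs_Im_le_norm_sin[of v] q_pos by (simp add: norm_mult norm_divide)
  moreover have "\<bar>Re v\<bar> \<le> pi" unfolding v_def by (rule Re_Arcsin_bound)
  moreover have "cmod v \<le> \<bar>Re v\<bar> + \<bar>Im v\<bar>" by (rule cmod_le)
  ultimately have "cmod v \<le> pi + cmod w / q" by linarith
  then have "cmod v / a \<le> (pi + cmod w / q) / a" using a_pos by (simp add: divide_right_mono)
  moreover have "cmod w \<le> nu + cmod v / a"
    using norm_triangle_ineq[of "of_real nu" "v / of_real a"] nu_pos a_pos
    by (simp add: norm_divide flip: w)
  moreover have "cmod w / (a * q) \<le> cmod w / 1000" using aq_ge by (intro divide_left_mono) auto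
  moreover have "(pi + cmod w / q) / a = pi / a + cmod w / (a * q)"
    by (simp add: add_divide_distrib mult.commute)
  ultimately have "cmod w \<le> nu + 2 * nu + cmod w / 1000" using pi_a_le by linarith
  then show ?thesis using nu_pos by linarith
qed

lemma step_argument:
  assumes "cmod w \<le> 6 * nu"
  shows "cmod (- \<i> * (w / of_real q)) \<le> 1/2"
proof -
  have "cmod w \<le> q / 2" using assms q_ge nu_pos by linarith
  then show ?thesis using q_pos by (simp add: norm_mult norm_divide field_simps)
qed

lemma step_diff:
  assumes "cmod v \<le> 6 * nu" "cmod w \<le> 6 * nu"
  shows "cmod (step v - step w) \<le> 2 / (a * q) * cmod (v - w)"
proof -
  have "cmod (step v - step w) =
      cmod (Arcsin (- \<i> * (v / of_real q)) - Arcsin (- \<i> * (w / of_real q))) / a"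
    using a_pos by (simp add: step_def norm_divide flip: diff_divide_distrib)
  also have "\<dots> \<le> 2 * cmod (- \<i> * (v / of_real q) - - \<i> * (w / of_real q)) / a"
    using a_pos assms by (intro divide_right_mono norm_Arcsin_diff step_argument) auto
  also have "- \<i> * (v / of_real q) - - \<i> * (w / of_real q) = - \<i> * ((v - w) / of_real q)"
    by (simp add: diff_divide_distrib algebra_simps)
  also have "2 * cmod (- \<i> * ((v - w) / of_real q)) / a = 2 / (a * q) * cmod (v - w)"
    using q_pos a_pos by (simp add: norm_mult norm_divide)
  finally show ?thesis .
qed

lemma step_near:
  assumes "cmod w \<le> 6 * nu"
  shows "cmod (step w - of_real nu) \<le> 12 * nu / (a * q)"
proof -
  have "cmod (step w - step 0) \<le> 2 / (a * q) * cmod w"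
    using step_diff[OF assms, of 0] nu_pos by simp
  also have "\<dots> \<le> 2 / (a * q) * (6 * nu)"
    using assms a_pos q_pos by (intro mult_left_mono) auto
  finally show ?thesis by (simp add: step_def)
qed

lemma near_bound: "12 * nu / (a * q) \<le> 0.012 / a" "12 * nu / (a * q) \<le> 0.012 * nu"
proof -
  have "12 * nu / q \<le> 0.012" using q_ge q_pos by (simp add: field_simps)
  then have "(12 * nu / q) / a \<le> 0.012 / a" using a_pos by (intro divide_right_mono) auto
  then show *: "12 * nu / (a * q) \<le> 0.012 / a" by (simp add: mult.commute)
  then show "12 * nu / (a * q) \<le> 0.012 * nu" using inverse_a_le by simp
qed

lemma step_fixpoint: "\<exists>!w. step w = w"
proof -
  have "\<exists>!w. w \<in> cball 0 (6 * nu) \<and> step w = w"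
  proof (rule Banach_fix[where c = "1/2"])
    show "step ` cball 0 (6 * nu) \<subseteq> cball 0 (6 * nu)"
    proof clarify
      fix w :: complex assume "w \<in> cball 0 (6 * nu)"
      then have "cmod (step w - of_real nu) \<le> 12 * nu / (a * q)" by (intro step_near) simp
      then have "cmod (step w) \<le> nu + 0.012 * nu"
        using norm_triangle_ineq[of "step w - of_real nu" "of_real nu"] near_bound nu_pos by simp
      then show "step w \<in> cball 0 (6 * nu)" using nu_pos by simp
    qed
    fix v w :: complex assume "v \<in> cball 0 (6 * nu)" "w \<in> cball 0 (6 * nu)"
    then have "cmod (step v - step w) \<le> 2 / (a * q) * cmod (v - w)" by (intro step_diff) auto
    also have "\<dots> \<le> 1/2 * cmod (v - w)"
      using aq_ge by (intro mult_right_mono) (auto simp: field_simps)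
    finally show "dist (step v) (step w) \<le> 1/2 * dist v w" by (simp add: dist_norm)
  qed (use nu_pos in \<open>auto intro: complete_eq_closed[THEN iffD2]\<close>)
  then show ?thesis using step_fixpoint_bound by auto
qed

lemma step_zeta: "step zeta = zeta"
  unfolding zeta_def by (rule theI'[OF step_fixpoint])

lemma zeta_near: "cmod (zeta - of_real nu) \<le> 12 * nu / (a * q)"
  using step_near[OF step_fixpoint_bound[OF step_zeta]] by (simp add: step_zeta)

lemma zeta_near': "cmod (zeta - of_real nu) \<le> 0.012 * nu"
  using zeta_near near_bound by linarith

lemma Re_zeta: "0.9 * nu \<le> Re zeta" "Re zeta \<le> 1.1 * nu"
  and Im_zeta_small: "\<bar>Im zeta\<bar> \<le> 0.1 * nu"
  and norm_zeta: "cmod zeta \<le> 1.1 * nu" "0.9 * nu \<le> cmod zeta"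
proof -
  show 1: "0.9 * nu \<le> Re zeta" "Re zeta \<le> 1.1 * nu" and "\<bar>Im zeta\<bar> \<le> 0.1 * nu"
    using zeta_near' abs_Re_le_cmod[of "zeta - of_real nu"] abs_Im_le_cmod[of "zeta - of_real nu"]
      nu_pos by auto
  show "cmod zeta \<le> 1.1 * nu"
    using zeta_near' norm_triangle_ineq[of "zeta - of_real nu" "of_real nu"] nu_pos by simp
  show "0.9 * nu \<le> cmod zeta" using 1 complex_Re_le_cmod[of zeta] by linarith
qed

lemma zeta_nonzero: "zeta \<noteq> 0"
  using norm_zeta nu_pos by auto

lemma norm_angle: "cmod ((zeta - of_real nu) * of_real a) \<le> 12 * nu / q"
  using mult_right_mono[OF zeta_near, of a] a_pos by (simp add: norm_mult)

lemma angle_small: "12 * nu / q \<le> 0.012"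
  using q_ge q_pos by (simp add: field_simps)

lemma sin_angle: "sin ((zeta - of_real nu) * of_real a) = - \<i> * (zeta / of_real q)"
proof -
  have "(zeta - of_real nu) * of_real a = Arcsin (- \<i> * (zeta / of_real q))"
    using step_zeta a_pos unfolding step_def by (simp add: field_simps)
  then show ?thesis by simp
qed

lemma cos_Re_angle_pos: "cos (Re ((zeta - of_real nu) * of_real a)) > 0"
proof -
  have "\<bar>Re ((zeta - of_real nu) * of_real a)\<bar> \<le> 0.012"
    using norm_angle angle_small abs_Re_le_cmod order_trans by metis
  then show ?thesis using pi_ge_two by (intro cos_gt_zero_pi) auto
qed

text \<open>Imaginary parts are compared in \<open>sin_angle\<close>: the right side has
  \<open>- Re zeta / q\<close>, while the sine has a positive cosine times the \<open>sinh\<close>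
  of \<open>Im zeta * a\<close>. This puts the resonance strictly below the real axis.\<close>

lemma Im_zeta_neg: "Im zeta < 0"
proof -
  define y where "y = Im zeta * a"
  have "Im (sin ((zeta - of_real nu) * of_real a)) = - (Re zeta / q)"
    unfolding sin_angle by simp
  also have "\<dots> < 0" using Re_zeta nu_pos q_pos by simp
  finally have "cos (Re ((zeta - of_real nu) * of_real a)) * (exp y - exp (- y)) < 0"
    unfolding Im_sin by (simp add: y_def)
  then have "exp y < exp (- y)" using cos_Re_angle_pos by (simp add: mult_less_0_iff)
  then show ?thesis using a_pos by (simp add: y_def mult_less_0_iff)
qed

section \<open>From the wave number back to the resonance\<close>

definition res :: complex where "res = csqrt (of_real (q\<^sup>2) + zeta\<^sup>2)"

lemma res_sq: "res\<^sup>2 = of_real (q\<^sup>2) + zeta\<^sup>2"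
  by (simp add: res_def)

lemma Re_zeta_sq: "0.8 * nu\<^sup>2 \<le> Re (zeta\<^sup>2)"
proof -
  have "(0.9 * nu)\<^sup>2 \<le> (Re zeta)\<^sup>2" using Re_zeta nu_pos by (intro power_mono) auto
  moreover have "\<bar>Im zeta\<bar>\<^sup>2 \<le> (0.1 * nu)\<^sup>2" using Im_zeta_small by (intro power_mono) auto
  ultimately show ?thesis by (simp add: power_mult_distrib power2_eq_square)
qed

lemma norm_res: "cmod res \<le> 2 * q" "q \<le> cmod res"
proof -
  have "cmod (zeta\<^sup>2) \<le> (1.1 * nu)\<^sup>2"
    unfolding norm_power using norm_zeta by (intro power_mono) auto
  also have "\<dots> \<le> q\<^sup>2" using q_ge nu_pos by (intro power_mono) auto
  finally have "cmod (res\<^sup>2) \<le> 2 * q\<^sup>2"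
    unfolding res_sq using norm_triangle_ineq[of "of_real (q\<^sup>2)" "zeta\<^sup>2"]
    by (simp del: of_real_power)
  also have "\<dots> \<le> (2 * q)\<^sup>2" by (simp add: power2_eq_square)
  finally show "cmod res \<le> 2 * q"
    unfolding norm_power by (rule power2_le_imp_le) (use q_pos in simp)
  have "q\<^sup>2 \<le> Re (res\<^sup>2)" unfolding res_sq
    using order_trans[OF _ Re_zeta_sq] by (simp del: of_real_power)
  also have "\<dots> \<le> (cmod res)\<^sup>2" using complex_Re_le_cmod[of "res\<^sup>2"] by (simp add: norm_power)
  finally show "q \<le> cmod res" by (rule power2_le_imp_le) simp
qed

lemma Re_res_pos: "Re res > 0" and Im_res_neg: "Im res < 0"
proof -
  have neg: "Im (res\<^sup>2) < 0"
    unfolding res_sq using Re_zeta nu_pos Im_zeta_neg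
    by (simp add: Im_power2 mult_pos_neg del: of_real_power)
  then have "2 * (Re res * Im res) < 0" by (simp add: Im_power2)
  moreover have "Re res \<ge> 0" unfolding res_def by (rule Re_csqrt)
  ultimately show "Re res > 0" "Im res < 0" by (auto simp: mult_less_0_iff)
qed

lemma ktilde_res: "ktilde lam res = zeta"
proof -
  have "ktilde lam res = csqrt (zeta\<^sup>2)" by (simp add: ktilde_def res_sq q_sq del: power2_csqrt)
  also have "\<dots> = zeta" using Re_zeta nu_pos by (intro csqrt_square) auto
  finally show ?thesis .
qed

lemma resonance_eq: "resonance a lam n = res"
  unfolding resonance_def
proof (rule the_equality)
  show "is_resonance a lam n res"
    unfolding is_resonance_iff ktilde_res using Re_res_pos Im_res_neg step_zeta
    by (simp add: step_def)
next
  fix w assume w: "is_resonance a lam n w"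
  then have "step (ktilde lam w) = ktilde lam w"
    unfolding is_resonance_iff step_def by simp
  then have "ktilde lam w = zeta" using step_fixpoint step_zeta by blast
  then have "w\<^sup>2 = of_real (q\<^sup>2) + zeta\<^sup>2" using ktilde_sq[of w] by simp
  \<comment> \<open>The condition \<open>Re w > 0\<close> selects the principal one of the two
    square roots.\<close>
  then show "w = res" unfolding res_def using w by (intro csqrt_unique[symmetric]) (auto simp: is_resonance_def)
qed


subsection \<open>The residue\<close>

text \<open>Keeps \<open>res\<close> off the branch cut of \<open>ktilde\<close>, so that
  \<open>F\<close> is holomorphic near it.\<close>

lemma zeta_sq_notin: "zeta\<^sup>2 \<notin> \<real>\<^sub>\<le>\<^sub>0"
proof -
  have "0 < 0.8 * nu\<^sup>2" using nu_pos by simp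
  then have "0 < Re (zeta\<^sup>2)" using Re_zeta_sq by linarith
  then show ?thesis by (simp add: complex_nonpos_Reals_iff)
qed

lemma res_nonzero: "res \<noteq> 0"
  using norm_res q_pos by auto

text \<open>Addition formulas around \<open>nu * a\<close>, where the cosine is 0 and the sine is
  \<open>sg\<close>. The small angle has sine \<open>- \<i> * zeta / q\<close>; its cosine is a root
  of \<open>1 + (zeta / q)\<^sup>2\<close>, and the positive cosine of its real part singles out
  \<open>res / q\<close>. These closed forms turn \<open>F a lam res = 0\<close> into an
  identity.\<close>

lemma sin_cos_zeta_a:
  shows "cos (zeta * of_real a) = \<i> * of_real sg * zeta / of_real q" (is ?c)
    and "sin (zeta * of_real a) = of_real sg * res / of_real q" (is ?s)
proof -
  define th where "th = (zeta - of_real nu) * of_real a"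
  have za: "zeta * of_real a = of_real (nu * a) + th" by (simp add: th_def algebra_simps)
  have sin_th: "sin th = - \<i> * (zeta / of_real q)" unfolding th_def by (rule sin_angle)
  have "csqrt (1 + (zeta / of_real q)\<^sup>2) = res / of_real q"
  proof (rule csqrt_unique)
    show "(res / of_real q)\<^sup>2 = 1 + (zeta / of_real q)\<^sup>2"
      using q_pos by (simp add: power_divide res_sq add_divide_distrib)
    show "0 < Re (res / of_real q) \<or> Re (res / of_real q) = 0 \<and> 0 \<le> Im (res / of_real q)"
      using Re_res_pos q_pos by simp
  qed
  moreover have "cos th = csqrt (1 - (sin th)\<^sup>2)"
    using cos_Re_angle_pos unfolding th_def by (intro cos_sin_csqrt) auto
  ultimately have cos_th: "cos th = res / of_real q"
    unfolding sin_th by (simp add: power_mult_distrib power_divide)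
  have nu_values: "cos (of_real (nu * a) :: complex) = 0" "sin (of_real (nu * a) :: complex) = of_real sg"
    by (simp_all only: cos_of_real sin_of_real cos_nu_a sg_def of_real_0)
  show ?c ?s unfolding za cos_add sin_add nu_values sin_th cos_th by simp_all
qed

text \<open>\<open>P\<close> is the derivative of \<open>F\<close> at the resonance with respect to \<open>ktilde\<close> instead of \<open>k\<close>;
  the factor \<open>res / zeta\<close> in \<open>F_deriv_res\<close> is the derivative of \<open>ktilde\<close>.\<close>

definition P :: complex where
  "P = - (of_real sg * of_real q * (of_real a * res + \<i>) / res\<^sup>2)"

lemma F_res: "F a lam res = 0"
  using res_nonzero by (simp add: F_def ktilde_res sin_cos_zeta_a)

lemma F_deriv_res: "(F a lam has_field_derivative P * res / zeta) (at res)"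
proof -
  have sq: "res\<^sup>2 - 2 * of_real lam = zeta\<^sup>2" by (simp add: res_sq q_sq)
  have cs: "csqrt (zeta\<^sup>2) = zeta" using ktilde_res by (simp add: ktilde_def sq)
  have kt: "(ktilde lam has_field_derivative res / zeta) (at res)"
    unfolding ktilde_def using zeta_sq_notin zeta_nonzero
    by (auto intro!: derivative_eq_intros simp: sq cs)
  have d: "res\<^sup>2 - zeta\<^sup>2 = of_real (q\<^sup>2)" by (simp add: res_sq)
  let ?s = "sin (zeta * of_real a)" and ?c = "cos (zeta * of_real a)"
  have "(F a lam has_field_derivative
      - ?s * (res / zeta * of_real a) - \<i> * (((res / zeta) * res - zeta) / (res * res) * ?s
        + zeta / res * (?c * (res / zeta * of_real a)))) (at res)"
    unfolding F_def using res_nonzero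
    by (auto intro!: derivative_eq_intros kt simp: ktilde_res field_simps)
  also have "- ?s * (res / zeta * of_real a) - \<i> * (((res / zeta) * res - zeta) / (res * res) * ?s
        + zeta / res * (?c * (res / zeta * of_real a))) = 
      - of_real sg / (of_real q * res * zeta) * (res\<^sup>2 - zeta\<^sup>2) * (of_real a * res + \<i>)"
    unfolding sin_cos_zeta_a using res_nonzero zeta_nonzero q_pos
    by (simp add: field_simps power2_eq_square)
  also have "\<dots> = P * res / zeta"
    unfolding P_def d using res_nonzero zeta_nonzero q_pos
    by (simp add: field_simps power2_eq_square)
  finally show ?thesis .
qed

lemma norm_k_plus_res: "q \<le> cmod (of_real k + res)" if "q \<le> k"
  using complex_Re_le_cmod[of "of_real k + res"] Re_res_pos that by simp

lemma norm_res_minus_q: "cmod (res - of_real q) \<le> 2 * nu"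
proof -
  have "cmod ((res - of_real q) * (res + of_real q)) = cmod (zeta\<^sup>2)"
    by (simp add: algebra_simps res_sq flip: power2_eq_square)
  also have "\<dots> \<le> (1.1 * nu)\<^sup>2"
    unfolding norm_power using norm_zeta by (intro power_mono) auto
  also have "\<dots> \<le> 2 * nu\<^sup>2" by (simp add: power_mult_distrib power2_eq_square)
  finally have "cmod (res - of_real q) * cmod (res + of_real q) \<le> 2 * nu\<^sup>2"
    by (simp add: norm_mult)
  moreover have "cmod (res - of_real q) * q \<le> cmod (res - of_real q) * cmod (res + of_real q)"
    using norm_k_plus_res[of q] by (intro mult_left_mono) (auto simp: add.commute)
  ultimately have "cmod (res - of_real q) * q \<le> 2 * nu\<^sup>2" by linarith
  also have "2 * nu\<^sup>2 \<le> 2 * nu * q" using q_ge nu_pos by (simp add: power2_eq_square)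
  finally show ?thesis using q_pos by simp
qed

text \<open>The limit \<open>- a * sg\<close> is the derivative of \<open>cos (w * a)\<close> at
  \<open>w = nu\<close>, the slope of \<open>F\<close> when the barrier is infinitely high.\<close>

lemma P_near: "cmod (P + of_real (a * sg)) \<le> 3 * (nu * a) / q"
proof -
  have rq: "cmod (res - of_real q) \<le> 2 * nu" by (rule norm_res_minus_q)
  have "P + of_real (a * sg) = of_real sg * (of_real a * ((res - of_real q) / res) - \<i> * of_real q / res\<^sup>2)"
    unfolding P_def using res_nonzero by (simp add: field_simps power2_eq_square)
  then have "cmod (P + of_real (a * sg)) = cmod (of_real a * ((res - of_real q) / res) - \<i> * of_real q / res\<^sup>2)"
    by (simp add: norm_mult abs_sg)
  also have "\<dots> \<le> a * (cmod (res - of_real q) / cmod res) + q / (cmod res)\<^sup>2"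
    using norm_triangle_ineq4[of "of_real a * ((res - of_real q) / res)" "\<i> * of_real q / res\<^sup>2"] a_pos q_pos
    by (simp add: norm_mult norm_divide norm_power)
  also have "\<dots> \<le> a * (2 * nu / q) + q / q\<^sup>2"
    using rq norm_res q_pos a_pos nu_pos
    by (intro add_mono mult_left_mono frac_le power_mono) auto
  also have "\<dots> \<le> 3 * (nu * a) / q"
    using nu_a_ge q_pos by (simp add: field_simps power2_eq_square)
  finally show ?thesis .
qed

lemma norm_P: "0.9 * a \<le> cmod P"
proof -
  have "3 * (nu * a) / q \<le> 0.1 * a" using q_ge q_pos a_pos by (simp add: field_simps)
  then have "cmod (P + of_real (a * sg)) \<le> 0.1 * a" using P_near by linarith
  moreover have "cmod (of_real (a * sg) :: complex) = a"
    using abs_sg a_pos by (simp add: norm_mult)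
  ultimately show ?thesis using norm_triangle_ineq[of "P + of_real (a * sg)" "- P"] by auto
qed

lemma residue_eq:
  "residue (\<lambda>w. 1 / (of_real (sqrt pi) * F a lam w)) (resonance a lam n)
     = zeta / (of_real (sqrt pi) * (P * res))"
proof -
  \<comment> \<open>\<open>S\<close> leaves out the branch cut of \<open>ktilde\<close> and the
    origin, where \<open>F\<close> need not be holomorphic.\<close>
  define S where "S = {w. w\<^sup>2 - 2 * of_real lam \<notin> \<real>\<^sub>\<le>\<^sub>0} \<inter> {w::complex. w \<noteq> 0}"
  have "open ((\<lambda>w. w\<^sup>2 - 2 * complex_of_real lam) -` (- \<real>\<^sub>\<le>\<^sub>0))"
    by (intro open_vimage open_Compl closed_nonpos_Reals_complex continuous_intros)
  then have "open S"
    unfolding S_def vimage_def by (intro open_Int open_Collect_neq continuous_intros) simp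
  moreover have "res \<in> S"
    using res_nonzero zeta_sq_notin by (simp add: S_def res_sq q_sq)
  ultimately obtain e where e: "e > 0" "ball res e \<subseteq> S" using openE by blast
  have hol: "(\<lambda>w. of_real (sqrt pi) * F a lam w) holomorphic_on ball res e"
    unfolding F_def ktilde_def using e(2)
    by (auto intro!: holomorphic_intros simp: S_def)
  have "P \<noteq> 0" using norm_P a_pos by auto
  have "residue (\<lambda>w. 1 / (of_real (sqrt pi) * F a lam w)) res = 1 / (of_real (sqrt pi) * (P * res / zeta))"
  proof (rule residue_simple_pole_deriv[where s = "ball res e"])
    show "((\<lambda>w. of_real (sqrt pi) * F a lam w) has_field_derivative of_real (sqrt pi) * (P * res / zeta)) (at res)"
      by (intro DERIV_cmult F_deriv_res)
    show "of_real (sqrt pi) * (P * res / zeta) \<noteq> 0"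
      using \<open>P \<noteq> 0\<close> res_nonzero zeta_nonzero by simp
  qed (use e hol F_res in auto)
  then show ?thesis by (simp add: resonance_eq)
qed


subsection \<open>Eigenfunctions at real energies\<close>

definition kap :: "real \<Rightarrow> real" where "kap k = sqrt (k\<^sup>2 - q\<^sup>2)"

lemma kap_sq: "q \<le> k \<Longrightarrow> (kap k)\<^sup>2 = k\<^sup>2 - q\<^sup>2"
  using q_pos by (simp add: kap_def)

lemma kap_nonneg: "q \<le> k \<Longrightarrow> 0 \<le> kap k"
  using q_pos by (simp add: kap_def)

lemma ktilde_above: "q \<le> k \<Longrightarrow> ktilde lam (of_real k) = of_real (kap k)"
  using q_sq kap_nonneg[of k] unfolding ktilde_def
  by (intro csqrt_unique) (auto simp: less_le kap_sq simp flip: of_real_power)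

lemma ktilde_below:
  assumes "0 < k" "k \<le> q"
  shows "ktilde lam (of_real k) = \<i> * of_real (sqrt (q\<^sup>2 - k\<^sup>2))"
  unfolding ktilde_def
proof (rule csqrt_unique)
  have "k\<^sup>2 \<le> q\<^sup>2" using assms by simp
  then show "(\<i> * of_real (sqrt (q\<^sup>2 - k\<^sup>2)))\<^sup>2 = (of_real k)\<^sup>2 - 2 * complex_of_real lam"
    by (simp add: power_mult_distrib q_sq flip: of_real_power)
  show "0 < Re (\<i> * complex_of_real (sqrt (q\<^sup>2 - k\<^sup>2))) \<or>
      Re (\<i> * complex_of_real (sqrt (q\<^sup>2 - k\<^sup>2))) = 0 \<and> 0 \<le> Im (\<i> * complex_of_real (sqrt (q\<^sup>2 - k\<^sup>2)))"
    using \<open>k\<^sup>2 \<le> q\<^sup>2\<close> by simp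
qed

lemma cos_i_times_of_real: "cos (\<i> * of_real x) = of_real (cosh x)"
  by (simp add: cos_exp_eq cosh_field_def exp_of_real mult.assoc[symmetric] flip: of_real_minus)

lemma sin_i_times_of_real: "sin (\<i> * of_real x) = \<i> * of_real (sinh x)"
  by (simp add: sin_exp_eq sinh_field_def exp_of_real mult.assoc[symmetric] field_simps flip: of_real_minus)

lemma norm_F_above:
  assumes "q \<le> k"
  shows "k\<^sup>2 * (cmod (F a lam (of_real k)))\<^sup>2 = (kap k)\<^sup>2 + q\<^sup>2 * (cos (kap k * a))\<^sup>2"
proof -
  have k: "0 < k" using assms q_pos by linarith
  have "F a lam (of_real k) = Complex (cos (kap k * a)) (- (kap k / k * sin (kap k * a)))"
    unfolding F_def ktilde_above[OF assms]
    by (simp add: complex_eq_iff cos_of_real sin_of_real flip: of_real_mult of_real_divide)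
  then have "(cmod (F a lam (of_real k)))\<^sup>2 = (cos (kap k * a))\<^sup>2 + (kap k / k)\<^sup>2 * (1 - (cos (kap k * a))\<^sup>2)"
    by (simp add: cmod_power2 power_mult_distrib power_divide sin_squared_eq)
  then show ?thesis using k kap_sq[OF assms] by (simp add: field_simps)
qed

lemma F_below:
  assumes "0 < k" "k \<le> q"
  shows "F a lam (of_real k) = Complex (cosh (sqrt (q\<^sup>2 - k\<^sup>2) * a)) (sqrt (q\<^sup>2 - k\<^sup>2) / k * sinh (sqrt (q\<^sup>2 - k\<^sup>2) * a))"
  unfolding F_def ktilde_below[OF assms]
  using cos_i_times_of_real[of "sqrt (q\<^sup>2 - k\<^sup>2) * a"] sin_i_times_of_real[of "sqrt (q\<^sup>2 - k\<^sup>2) * a"]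
  by (simp add: complex_eq_iff mult.assoc flip: of_real_mult of_real_divide)

text \<open>Above the barrier \<open>\<bar>F\<bar>\<^sup>2\<close> is the squared cosine plus a
  nonnegative sine term; below it the cosine is a \<open>cosh\<close> and equals the real part of
  \<open>F\<close>. Its main use is to cancel the \<open>1 / F\<close> in \<open>psi_hat\<close>, so
  that a peak enters the integrand through \<open>phi\<close> only.\<close>

lemma norm_cos_le_norm_F:
  assumes "0 < k"
  shows "cmod (cos (ktilde lam (of_real k) * of_real a)) \<le> cmod (F a lam (of_real k))"
proof (cases "q \<le> k")
  case True
  have "k\<^sup>2 * (cos (kap k * a))\<^sup>2 + (kap k)\<^sup>2 * (1 - (cos (kap k * a))\<^sup>2) = k\<^sup>2 * (cmod (F a lam (of_real k)))\<^sup>2"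
    unfolding norm_F_above[OF True] kap_sq[OF True] by (simp add: algebra_simps)
  moreover have "0 \<le> (kap k)\<^sup>2 * (1 - (cos (kap k * a))\<^sup>2)"
    by (simp add: abs_square_le_1)
  ultimately have "k\<^sup>2 * (cos (kap k * a))\<^sup>2 \<le> k\<^sup>2 * (cmod (F a lam (of_real k)))\<^sup>2" by linarith
  then have "\<bar>cos (kap k * a)\<bar>\<^sup>2 \<le> (cmod (F a lam (of_real k)))\<^sup>2" using assms by simp
  then have "\<bar>cos (kap k * a)\<bar> \<le> cmod (F a lam (of_real k))" by (rule power2_le_imp_le) simp
  then show ?thesis
    by (simp add: ktilde_above[OF True] cos_of_real flip: of_real_mult)
next
  case False
  then show ?thesis
    using F_below[of k] abs_Re_le_cmod[of "F a lam (of_real k)"] assms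
      cos_i_times_of_real[of "sqrt (q\<^sup>2 - k\<^sup>2) * a"]
    by (simp add: ktilde_below mult.assoc)
qed

lemma norm_F_pos:
  assumes "0 < k"
  shows "0 < cmod (F a lam (of_real k))"
proof (cases "q \<le> k")
  case True
  have "(kap k)\<^sup>2 + q\<^sup>2 * (cos (kap k * a))\<^sup>2 > 0"
    using q_pos by (cases "kap k = 0") (auto intro: add_pos_nonneg)
  then have "F a lam (of_real k) \<noteq> 0" unfolding norm_F_above[OF True, symmetric] by auto
  then show ?thesis by simp
next
  case False
  then have "Re (F a lam (of_real k)) > 0" using F_below[of k] assms by (simp add: cosh_real_pos)
  then show ?thesis by auto
qed

lemma cnj_cos_ktilde:
  assumes "0 < k"
  shows "cnj (cos (ktilde lam (of_real k) * of_real x)) = cos (ktilde lam (of_real k) * of_real x)"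
proof (cases "q \<le> k")
  case True
  then show ?thesis by (simp add: ktilde_above cos_of_real flip: of_real_mult)
next
  case False
  then show ?thesis using assms cos_i_times_of_real[of "sqrt (q\<^sup>2 - k\<^sup>2) * x"]
    by (simp add: ktilde_below mult.assoc)
qed

section \<open>Overlap of the initial state with the eigenfunctions\<close>

definition overlap :: "complex \<Rightarrow> complex" where
  "overlap w = (LBINT x:{-a..a}. cos (of_real (nu * x)) * cos (w * of_real x))"

lemma psi_hat_eq:
  assumes "0 < k"
  shows "psi_hat a lam n k =
    cnj (exp (- \<i> * of_real (k * a)) / (of_real (sqrt pi) * F a lam (of_real k)))
      * overlap (ktilde lam (of_real k))"
proof -
  let ?c = "cnj (exp (- \<i> * of_real (k * a)) / (of_real (sqrt pi) * F a lam (of_real k)))"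
  have "psi_hat a lam n k =
      (LBINT x. ?c * (indicator {-a..a} x *\<^sub>R (cos (of_real (nu * x)) * cos (ktilde lam (of_real k) * of_real x))))"
    unfolding psi_hat_def
  proof (rule Bochner_Integration.integral_cong[OF refl])
    fix x :: real
    show "of_real (psi a n x) * cnj (phi a lam k x) =
      ?c * (indicator {-a..a} x *\<^sub>R (cos (of_real (nu * x)) * cos (ktilde lam (of_real k) * of_real x)))"
    proof (cases "x \<in> {-a..a}")
      case True
      then have "\<bar>x\<bar> \<le> a" by auto
      moreover have "of_real (psi a n x) = cos (complex_of_real (nu * x))"
        using True by (simp only: cos_of_real) (simp add: psi_def nu_def)
      ultimately show ?thesis using True cnj_cos_ktilde[OF assms, of x] by (simp add: phi_def)
    qed (simp add: psi_def)
  qed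
  then show ?thesis
    by (simp only: overlap_def set_lebesgue_integral_def integral_mult_right_zero)
qed

text \<open>An explicit antiderivative. As \<open>cos (nu * a) = 0\<close>, only the boundary term
  with \<open>cos (w * a)\<close> survives, and this is the factor that \<open>F\<close>
  dominates.\<close>

lemma overlap_eq:
  assumes "w\<^sup>2 \<noteq> of_real (nu\<^sup>2)"
  shows "overlap w = 2 * of_real (nu * sg) * cos (w * of_real a) / (of_real (nu\<^sup>2) - w\<^sup>2)"
proof -
  define G where "G x = (of_real nu * sin (of_real (nu * x)) * cos (w * of_real x)
      - w * cos (of_real (nu * x)) * sin (w * of_real x)) / (of_real (nu\<^sup>2) - w\<^sup>2)" for x
  have nz: "of_real (nu\<^sup>2) - w\<^sup>2 \<noteq> 0" using assms by auto
  have "(G has_vector_derivative cos (of_real (nu * x)) * cos (w * of_real x)) (at x within {-a..a})" for x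
  proof -
    define g where "g y = (of_real nu * sin (of_real nu * y) * cos (w * y)
      - w * cos (of_real nu * y) * sin (w * y)) / (of_real (nu\<^sup>2) - w\<^sup>2)" for y
    have "((\<lambda>y. of_real nu * sin (of_real nu * y) * cos (w * y) - w * cos (of_real nu * y) * sin (w * y))
      has_field_derivative (of_real (nu\<^sup>2) - w\<^sup>2) * (cos (of_real nu * of_real x) * cos (w * of_real x)))
      (at (of_real x))"
      by (auto intro!: derivative_eq_intros simp: algebra_simps power2_eq_square)
    then have "(g has_field_derivative ((of_real (nu\<^sup>2) - w\<^sup>2) * (cos (of_real nu * of_real x) * cos (w * of_real x)))
        / (of_real (nu\<^sup>2) - w\<^sup>2)) (at (of_real x))"
      unfolding g_def by (rule DERIV_cdivide)
    then have "(g has_field_derivative cos (of_real nu * of_real x) * cos (w * of_real x)) (at (of_real x))"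
      using nz by simp
    from has_vector_derivative_real_field[OF this] show ?thesis
      by (simp add: G_def[abs_def] g_def)
  qed
  then have "overlap w = G a - G (- a)"
    unfolding overlap_def set_lebesgue_integral_def using a_pos
    by (intro integral_FTC_Icc) (auto intro!: continuous_intros)
  also have "\<dots> = 2 * of_real (nu * sg) * cos (w * of_real a) / (of_real (nu\<^sup>2) - w\<^sup>2)"
  proof -
    have "cos (complex_of_real nu * of_real a) = 0" "sin (complex_of_real nu * of_real a) = of_real sg"
      using cos_nu_a by (simp_all add: sg_def cos_of_real sin_of_real flip: of_real_mult)
    then show ?thesis by (simp add: G_def flip: add_divide_distrib)
  qed
  finally show ?thesis .
qed

lemma sqrt_pi_ge_1: "1 \<le> sqrt pi"
  using pi_ge_two by simp

lemma norm_psi_hat: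
  assumes "0 < k" "k\<^sup>2 - q\<^sup>2 \<noteq> nu\<^sup>2"
  shows "cmod (psi_hat a lam n k) \<le> 2 * nu / \<bar>nu\<^sup>2 - (k\<^sup>2 - q\<^sup>2)\<bar>"
proof -
  let ?F = "cmod (F a lam (of_real k))" and ?c = "cmod (cos (ktilde lam (of_real k) * of_real a))"
  have w: "(ktilde lam (of_real k))\<^sup>2 = of_real (k\<^sup>2 - q\<^sup>2)" by (simp add: ktilde_sq)
  have "cmod (psi_hat a lam n k) = 1 / (sqrt pi * ?F) * cmod (overlap (ktilde lam (of_real k)))"
    unfolding psi_hat_eq[OF assms(1)] by (simp add: norm_mult norm_divide)
  also have "cmod (overlap (ktilde lam (of_real k))) = 2 * nu * ?c / \<bar>nu\<^sup>2 - (k\<^sup>2 - q\<^sup>2)\<bar>"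
    using assms(2) nu_pos by (subst overlap_eq)
      (auto simp: w norm_mult norm_divide abs_sg simp flip: of_real_diff of_real_power)
  also have "1 / (sqrt pi * ?F) * (2 * nu * ?c / \<bar>nu\<^sup>2 - (k\<^sup>2 - q\<^sup>2)\<bar>)
      = ?c / ?F * (1 / sqrt pi) * (2 * nu / \<bar>nu\<^sup>2 - (k\<^sup>2 - q\<^sup>2)\<bar>)" by (simp add: mult_ac)
  also have "\<dots> \<le> 1 * 1 * (2 * nu / \<bar>nu\<^sup>2 - (k\<^sup>2 - q\<^sup>2)\<bar>)"
    using norm_cos_le_norm_F[OF assms(1)] norm_F_pos[OF assms(1)] sqrt_pi_ge_1 nu_pos
    by (intro mult_right_mono mult_mono) auto
  finally show ?thesis by simp
qed

text \<open>Complements \<open>norm_psi_hat\<close> near \<open>kap k = nu\<close>, where that bound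
  blows up: the overlap is simply bounded by the length of the interval, at the price of keeping
  \<open>1 / F\<close>.\<close>

lemma norm_psi_hat_above:
  assumes "q \<le> k"
  shows "cmod (psi_hat a lam n k) \<le> 2 * a / cmod (F a lam (of_real k))"
proof -
  have k: "0 < k" using assms q_pos by linarith
  have "cmod (overlap (ktilde lam (of_real k))) \<le> (LBINT x. indicator {-a..a} x :: real)"
    unfolding overlap_def set_lebesgue_integral_def ktilde_above[OF assms]
  proof (rule order_trans[OF integral_norm_bound integral_mono'])
    show "integrable lborel (indicator {-a..a} :: real \<Rightarrow> real)"
      by (intro integrable_real_indicator) (auto simp: emeasure_lborel_Icc_eq)
    show "cmod (indicator {-a..a} x *\<^sub>R (cos (complex_of_real (nu * x)) * cos (complex_of_real (kap k) * of_real x)))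
        \<le> indicator {-a..a} x" for x
      using mult_mono[OF abs_cos_le_one[of "nu * x"] abs_cos_le_one[of "kap k * x"]]
      by (simp add: norm_mult cos_of_real indicator_def abs_mult flip: of_real_mult)
  qed simp
  also have "\<dots> = 2 * a" using a_pos by simp
  finally have "cmod (overlap (ktilde lam (of_real k))) \<le> 2 * a" .
  then have "1 / sqrt pi * cmod (overlap (ktilde lam (of_real k))) \<le> 1 * (2 * a)"
    using sqrt_pi_ge_1 by (intro mult_mono) auto
  then have "1 / sqrt pi * cmod (overlap (ktilde lam (of_real k))) / cmod (F a lam (of_real k))
      \<le> 2 * a / cmod (F a lam (of_real k))" by (intro divide_right_mono) auto
  then show ?thesis unfolding psi_hat_eq[OF k] by (simp add: norm_mult norm_divide)
qed

text \<open>\<open>eta\<close> without its factor \<open>exp (-\<i> * k * a) / sqrt pi\<close>, which it shares with \<open>phi\<close>.\<close>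

definition pole :: "real \<Rightarrow> complex" where
  "pole k = zeta / (P * res * (of_real k - res))"

lemma k_minus_res_nonzero: "of_real k - res \<noteq> 0"
  using Im_res_neg by (auto simp: complex_eq_iff)

lemma norm_phi_minus_gamow:
  assumes "\<bar>x\<bar> \<le> a"
  shows "cmod (phi a lam k x - eta a lam n k * gamow a lam n x) \<le>
    cmod (cos (ktilde lam (of_real k) * of_real x) / F a lam (of_real k) - pole k * cos (zeta * of_real x))"
proof -
  have "phi a lam k x - eta a lam n k * gamow a lam n x =
     exp (- \<i> * of_real (k * a)) / of_real (sqrt pi) *
      (cos (ktilde lam (of_real k) * of_real x) / F a lam (of_real k) - pole k * cos (zeta * of_real x))"
    using assms unfolding phi_def eta_def gamow_def residue_eq pole_def
    by (simp add: resonance_eq ktilde_res algebra_simps)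
  then have "cmod (phi a lam k x - eta a lam n k * gamow a lam n x) = 1 / sqrt pi *
    cmod (cos (ktilde lam (of_real k) * of_real x) / F a lam (of_real k) - pole k * cos (zeta * of_real x))"
    by (simp add: norm_mult norm_divide)
  also have "\<dots> \<le> 1 * cmod (cos (ktilde lam (of_real k) * of_real x) / F a lam (of_real k) - pole k * cos (zeta * of_real x))"
    using sqrt_pi_ge_1 by (intro mult_right_mono) auto
  finally show ?thesis by simp
qed

text \<open>Since \<open>res\<^sup>2 = q\<^sup>2 + zeta\<^sup>2\<close>, the denominator
  \<open>k - res\<close> can be traded for \<open>(kap k)\<^sup>2 - zeta\<^sup>2\<close>, which
  moves the estimates to the wave number inside the barrier.\<close>

lemma pole_eq:
  "pole k = zeta * (of_real k + res) / (P * res * (of_real (k\<^sup>2 - q\<^sup>2) - zeta\<^sup>2))"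
    and k_zeta_nonzero: "of_real (k\<^sup>2 - q\<^sup>2) - zeta\<^sup>2 \<noteq> 0" if "0 < k"
proof -
  have d: "of_real (k\<^sup>2 - q\<^sup>2) - zeta\<^sup>2 = (of_real k - res) * (of_real k + res)"
    using res_sq by (simp add: algebra_simps flip: power2_eq_square)
  have nz: "of_real k + res \<noteq> 0" using Re_res_pos that by (auto simp: complex_eq_iff)
  then show "of_real (k\<^sup>2 - q\<^sup>2) - zeta\<^sup>2 \<noteq> 0"
    unfolding d using k_minus_res_nonzero by simp
  show "pole k = zeta * (of_real k + res) / (P * res * (of_real (k\<^sup>2 - q\<^sup>2) - zeta\<^sup>2))"
    unfolding pole_def d using nz by simp
qed

lemma norm_pole:
  assumes "0 < k"
  shows "cmod (pole k) \<le> 2 * nu / a * (k + 2 * q) / (q * cmod (of_real (k\<^sup>2 - q\<^sup>2) - zeta\<^sup>2))"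
proof -
  let ?d = "cmod (of_real (k\<^sup>2 - q\<^sup>2) - zeta\<^sup>2)"
  have d: "?d > 0" using k_zeta_nonzero[OF assms] by simp
  have "cmod (of_real k + res) \<le> k + 2 * q"
    using norm_triangle_ineq[of "of_real k" res] norm_res assms by simp
  then have "cmod zeta * cmod (of_real k + res) \<le> (1.1 * nu) * (k + 2 * q)"
    using norm_zeta nu_pos by (intro mult_mono) auto
  moreover have "0.9 * a * q * ?d \<le> cmod P * cmod res * ?d"
    using norm_P norm_res a_pos q_pos by (intro mult_right_mono mult_mono) auto
  moreover have "0 < 0.9 * a * q * ?d" using a_pos q_pos d by simp
  ultimately have "cmod (pole k) \<le> (1.1 * nu) * (k + 2 * q) / (0.9 * a * q * ?d)"
    unfolding pole_eq[OF assms] norm_divide norm_mult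
    using nu_pos q_pos assms by (intro frac_le) auto
  also have "\<dots> = 11 / 9 * (nu / a * (k + 2 * q) / (q * ?d))"
  proof -
    have "(1.1 * A) * B / (0.9 * a * q * D) = 11 / 9 * (A / a * B / (q * D))" for A B D :: real
      using a_pos q_pos by (cases "D = 0") (simp_all add: field_simps)
    then show ?thesis .
  qed
  also have "\<dots> \<le> 2 * (nu / a * (k + 2 * q) / (q * ?d))"
    using nu_pos a_pos q_pos assms by (intro mult_right_mono) auto
  finally show ?thesis by simp
qed

lemma Im_zeta_x_small:
  assumes "\<bar>x\<bar> \<le> a"
  shows "\<bar>Im (zeta * of_real x)\<bar> \<le> 1"
proof -
  have "\<bar>Im zeta\<bar> \<le> 0.012 / a"
    using abs_Im_le_cmod[of "zeta - of_real nu"] zeta_near near_bound by simp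
  then have "\<bar>Im zeta\<bar> * \<bar>x\<bar> \<le> 0.012 / a * a" using assms a_pos by (intro mult_mono) auto
  then show ?thesis using a_pos by (simp add: abs_mult)
qed

lemma norm_cos_zeta_x: "\<bar>x\<bar> \<le> a \<Longrightarrow> cmod (cos (zeta * of_real x)) \<le> 2"
  by (intro norm_cos_strip Im_zeta_x_small)

subsection \<open>Pointwise bounds for the integrand\<close>

definition period :: real where "period = pi / a"

text \<open>The positive zeros of \<open>cos (w * a)\<close>, each the midpoint of a period. For
  \<open>n = 2 * m + 1\<close> the number \<open>nu\<close> is the zero with index
  \<open>m\<close>.\<close>

definition centre :: "nat \<Rightarrow> real" where "centre m = (real m + 1/2) * period"

lemma period_pos: "0 < period"
  using a_pos by (simp add: period_def)

lemma period_ends: "real m * period = centre m - period / 2" "(real m + 1) * period = centre m + period / 2"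
  by (simp_all add: centre_def algebra_simps)

lemma abs_cos_ge:
  assumes "real m * period \<le> w" "w \<le> (real m + 1) * period"
  shows "a * \<bar>w - centre m\<bar> / 2 \<le> \<bar>cos (w * a)\<bar>"
proof -
  define t where "t = (w - centre m) * a"
  have wa: "w * a = t + real m * pi + pi / 2"
    using a_pos by (simp add: t_def centre_def period_def field_simps)
  have "\<bar>w - centre m\<bar> \<le> period / 2"
    using assms unfolding period_ends abs_le_iff by linarith
  then have "\<bar>t\<bar> \<le> period / 2 * a"
    using a_pos by (simp add: t_def abs_mult)
  then have "\<bar>t\<bar> \<le> pi / 2" using a_pos by (simp add: period_def)
  then have "\<bar>t\<bar> / 2 \<le> \<bar>sin t\<bar>" by (rule half_abs_le_abs_sin)
  moreover have "\<bar>cos (w * a)\<bar> = \<bar>sin t\<bar>"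
    unfolding wa by (simp add: cos_add sin_add abs_mult sin_npi2 flip: power_abs)
  ultimately show ?thesis using a_pos by (simp add: t_def abs_mult mult.commute)
qed

section \<open>Below the barrier and away from the resonance\<close>

definition error_density :: "real \<Rightarrow> real \<Rightarrow> real" where
  "error_density x k = cmod (psi_hat a lam n k) * cmod (phi a lam k x - eta a lam n k * gamow a lam n x)"

lemma error_density_nonneg: "0 \<le> error_density x k"
  by (simp add: error_density_def)

text \<open>The eigenfunction part is at most 1, because \<open>cosh\<close> at \<open>x\<close> is
  at most \<open>cosh\<close> at \<open>a\<close>, hence at most \<open>\<bar>F\<bar>\<close>. The
  pole part is at most 15, because \<open>k\<^sup>2 - q\<^sup>2 \<le> 0\<close> keeps the
  denominator away from 0. Only the overlap decays, which gives \<open>32 = 2 * 16\<close>.\<close>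

lemma error_density_below:
  assumes "\<bar>x\<bar> \<le> a" "0 < k" "k \<le> q"
  shows "error_density x k \<le> 32 * nu / (nu\<^sup>2 + q * (q - k))"
proof -
  let ?F = "cmod (F a lam (of_real k))"
  define mu where "mu = sqrt (q\<^sup>2 - k\<^sup>2)"
  have "k\<^sup>2 \<le> q\<^sup>2" using assms by simp
  have "cmod (cos (ktilde lam (of_real k) * of_real x)) = cosh (mu * x)" for x
    using cos_i_times_of_real[of "mu * x"] cosh_real_pos[of "mu * x"] assms
    by (simp add: ktilde_below mu_def mult.assoc)
  note c = this
  have "cosh (mu * x) \<le> cosh (mu * a)"
  proof -
    have "\<bar>mu * x\<bar> \<le> \<bar>mu * a\<bar>" using assms(1) a_pos by (simp add: abs_mult mult_left_mono)
    then have "cosh \<bar>mu * x\<bar> \<le> cosh \<bar>mu * a\<bar>" by (subst cosh_real_nonneg_le_iff) auto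
    then show ?thesis by (simp only: cosh_real_abs)
  qed
  then have "cmod (cos (ktilde lam (of_real k) * of_real x)) \<le> ?F"
    using norm_cos_le_norm_F[OF assms(2)] unfolding c by linarith
  then have c1: "cmod (cos (ktilde lam (of_real k) * of_real x) / F a lam (of_real k)) \<le> 1"
    using norm_F_pos[OF assms(2)] by (simp add: norm_divide)
  have "0.8 * nu\<^sup>2 \<le> Re (zeta\<^sup>2 - of_real (k\<^sup>2 - q\<^sup>2))"
    using Re_zeta_sq \<open>k\<^sup>2 \<le> q\<^sup>2\<close> by (simp del: of_real_power of_real_diff)
  also have "\<dots> \<le> cmod (of_real (k\<^sup>2 - q\<^sup>2) - zeta\<^sup>2)"
    by (metis complex_Re_le_cmod norm_minus_commute)
  finally have d: "0.8 * nu\<^sup>2 \<le> cmod (of_real (k\<^sup>2 - q\<^sup>2) - zeta\<^sup>2)" .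
  have "cmod (pole k) \<le> 2 * nu / a * (k + 2 * q) / (q * cmod (of_real (k\<^sup>2 - q\<^sup>2) - zeta\<^sup>2))"
    by (rule norm_pole[OF assms(2)])
  also have "\<dots> \<le> 2 * nu / a * (3 * q) / (q * (0.8 * nu\<^sup>2))"
    using d assms q_pos nu_pos a_pos by (intro frac_le mult_left_mono mult_nonneg_nonneg mult_pos_pos) auto
  also have "\<dots> = 7.5 / (nu * a)"
    using q_pos nu_pos a_pos by (simp add: field_simps power2_eq_square)
  also have "\<dots> \<le> 7.5" using nu_a_ge by (simp add: field_simps)
  finally have "cmod (pole k) * cmod (cos (zeta * of_real x)) \<le> 7.5 * 2"
    using norm_cos_zeta_x[OF assms(1)] by (intro mult_mono) auto
  then have D: "cmod (phi a lam k x - eta a lam n k * gamow a lam n x) \<le> 16"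
    using norm_phi_minus_gamow[OF assms(1), of k] c1
      norm_triangle_ineq4[of "cos (ktilde lam (of_real k) * of_real x) / F a lam (of_real k)" "pole k * cos (zeta * of_real x)"]
    by (simp add: norm_mult)
  \<comment> \<open>Linear in \<open>k\<close>, so that the resulting bound has a logarithm as its
    antiderivative.\<close>
  have q_k: "q * (q - k) \<le> q\<^sup>2 - k\<^sup>2"
    using mult_right_mono[of k q k] assms by (simp add: algebra_simps power2_eq_square)
  have "cmod (psi_hat a lam n k) \<le> 2 * nu / \<bar>nu\<^sup>2 - (k\<^sup>2 - q\<^sup>2)\<bar>"
    using \<open>k\<^sup>2 \<le> q\<^sup>2\<close> zero_less_power[OF nu_pos, of 2] by (intro norm_psi_hat assms) linarith
  also have "\<dots> \<le> 2 * nu / (nu\<^sup>2 + q * (q - k))"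
  proof -
    have "0 < nu\<^sup>2 + q * (q - k)" using assms q_pos nu_pos by (intro add_pos_nonneg) auto
    moreover have "nu\<^sup>2 + q * (q - k) \<le> \<bar>nu\<^sup>2 - (k\<^sup>2 - q\<^sup>2)\<bar>" using q_k by linarith
    ultimately show ?thesis using nu_pos by (intro divide_left_mono) auto
  qed
  finally have psi: "cmod (psi_hat a lam n k) \<le> 2 * nu / (nu\<^sup>2 + q * (q - k))" .
  then have "error_density x k \<le> 2 * nu / (nu\<^sup>2 + q * (q - k)) * 16"
    unfolding error_density_def using D order_trans[OF norm_ge_zero psi] by (intro mult_mono) auto
  then show ?thesis by simp
qed

text \<open>\<open>1 / \<bar>F\<bar>\<close> times the Jacobian \<open>w / k\<close> of the substitution \<open>k = sqrt (q\<^sup>2 + w\<^sup>2)\<close>.\<close>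

definition weight :: "real \<Rightarrow> real" where
  "weight w = w / sqrt (w\<^sup>2 + q\<^sup>2 * (cos (w * a))\<^sup>2)"

lemma weight_eq:
  assumes "q \<le> k"
  shows "kap k / k * (1 / cmod (F a lam (of_real k))) = weight (kap k)"
proof -
  have "k > 0" using assms q_pos by linarith
  then have "sqrt ((kap k)\<^sup>2 + q\<^sup>2 * (cos (kap k * a))\<^sup>2) = k * cmod (F a lam (of_real k))"
    unfolding norm_F_above[OF assms, symmetric] by (simp add: real_sqrt_mult)
  then show ?thesis by (simp add: weight_def)
qed

lemma nu_eq_centre: "n = Suc (2 * m) \<Longrightarrow> nu = centre m"
  using a_pos unfolding nu_def centre_def period_def by (simp add: field_simps)

text \<open>\<open>nu\<close> is the midpoint of another period, so \<open>w = kap k\<close> is at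
  least half a period away from it, and \<open>\<bar>nu\<^sup>2 - w\<^sup>2\<bar>\<close> grows
  quadratically in \<open>m + 1\<close>; \<open>zeta\<close> is so close to \<open>nu\<close> that
  the same holds for it. The overlap thus supplies the decay without any \<open>1 / F\<close>. The
  \<open>1 / F\<close> of the eigenfunction becomes \<open>weight\<close>, and the pole term leaves
  \<open>1 / q\<close>.\<close>

lemma error_density_off_resonance:
  assumes x: "\<bar>x\<bar> \<le> a" and k: "q \<le> k"
    and m: "real m * period \<le> kap k" "kap k \<le> (real m + 1) * period" "n \<noteq> Suc (2 * m)"
  shows "kap k / k * error_density x k
    \<le> 4 * nu * (real n + 3) / period\<^sup>2 * (1 + 48 * nu * (real n + 3)) / (real m + 1)\<^sup>2 * (weight (kap k) + 1 / q)"
proof -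
  define w where "w = kap k"
  define M where "M = real m + 1"
  define d where "d = M\<^sup>2 * period\<^sup>2 / (2 * (real n + 3))"
  have M: "1 \<le> M" by (simp add: M_def)
  have kpos: "0 < k" using k q_pos by linarith
  have w0: "0 \<le> w" unfolding w_def by (rule kap_nonneg[OF k])
  have wsq: "k\<^sup>2 - q\<^sup>2 = w\<^sup>2" unfolding w_def kap_sq[OF k] ..
  have d_pos: "0 < d" using M period_pos by (simp add: d_def add_nonneg_pos)
  obtain m0 where m0: "n = Suc (2 * m0)" using odd_n by (auto elim: oddE)
  have nu_c: "nu = centre m0" by (rule nu_eq_centre[OF m0])
  have "m \<noteq> m0" using m(3) m0 by simp
  have dist: "period / 2 \<le> \<bar>w - nu\<bar>"
  proof (cases "m < m0")
    case True
    then have "real m + 1 \<le> real m0" by simp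
    then have "(real m + 1) * period \<le> real m0 * period" using period_pos by simp
    then show ?thesis using m(2) nu_c period_ends(1)[of m0] period_pos unfolding w_def by linarith
  next
    case False
    then have "real m0 + 1 \<le> real m" using \<open>m \<noteq> m0\<close> by simp
    then have "(real m0 + 1) * period \<le> real m * period" using period_pos by simp
    then show ?thesis using m(1) nu_c period_ends(2)[of m0] period_pos unfolding w_def by linarith
  qed
  have nu_n: "nu = real n / 2 * period" using a_pos by (simp add: nu_def period_def)
  \<comment> \<open>\<open>M * period\<close> exceeds \<open>\<bar>w - nu\<bar>\<close> by at most
    \<open>(n / 2 + 1) * period\<close>, and \<open>dist\<close> absorbs this excess.\<close>
  have "M * period \<le> \<bar>w - nu\<bar> + (real n / 2 + 1) * period"
    using m(1) nu_n by (simp add: M_def w_def algebra_simps)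
  also have "(real n / 2 + 1) * period \<le> (real n + 2) * \<bar>w - nu\<bar>"
    using mult_left_mono[OF dist, of "real n + 2"] by (simp add: algebra_simps)
  finally have 1: "M * period / (real n + 3) \<le> \<bar>w - nu\<bar>"
    by (simp add: field_simps)
  have "real m * period + 1/2 * period \<le> w + nu"
    using m(1) nu_n n_ge_1 period_pos by (intro add_mono) (auto simp: w_def)
  moreover have "M * period / 2 \<le> real m * period + 1/2 * period"
    using period_pos by (simp add: M_def algebra_simps)
  ultimately have 2: "M * period / 2 \<le> w + nu" by linarith
  have "d = (M * period / (real n + 3)) * (M * period / 2)"
    by (simp add: d_def power2_eq_square mult_ac)
  also have "\<dots> \<le> \<bar>w - nu\<bar> * (w + nu)"
    using 1 2 M period_pos by (intro mult_mono) auto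
  finally have d_le: "d \<le> \<bar>w - nu\<bar> * (w + nu)" .
  also have "\<dots> = \<bar>nu\<^sup>2 - w\<^sup>2\<bar>"
  proof -
    have "nu\<^sup>2 - w\<^sup>2 = - ((w - nu) * (w + nu))" by (simp add: power2_eq_square algebra_simps)
    then show ?thesis using w0 nu_pos by (simp only: abs_minus_cancel abs_mult)
  qed
  finally have d_nu: "d \<le> \<bar>nu\<^sup>2 - w\<^sup>2\<bar>" .
  have "cmod (psi_hat a lam n k) \<le> 2 * nu / \<bar>nu\<^sup>2 - w\<^sup>2\<bar>"
    unfolding wsq[symmetric] using d_nu d_pos wsq by (intro norm_psi_hat kpos) auto
  also have "\<dots> \<le> 2 * nu / d" using d_nu d_pos nu_pos by (intro divide_left_mono) auto
  finally have psi: "cmod (psi_hat a lam n k) \<le> 2 * nu / d" .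
  have zd: "d / 4 \<le> cmod (of_real (k\<^sup>2 - q\<^sup>2) - zeta\<^sup>2)"
  proof -
    have "cmod (zeta - of_real nu) \<le> \<bar>w - nu\<bar> / 2"
    proof -
      have "0.012 / a \<le> (pi / 4) / a" using a_pos pi_ge_two by (intro divide_right_mono) auto
      then have "0.012 / a \<le> period / 4" by (simp add: period_def)
      then have "cmod (zeta - of_real nu) \<le> period / 4"
        using zeta_near near_bound(1) by (meson order_trans)
      also have "\<dots> \<le> \<bar>w - nu\<bar> / 2" using dist by simp
      finally show ?thesis .
    qed
    moreover have "\<bar>w - nu\<bar> \<le> cmod (of_real w - zeta) + cmod (zeta - of_real nu)"
      using norm_triangle_ineq[of "of_real w - zeta" "zeta - of_real nu"] by (simp flip: of_real_diff)
    ultimately have 3: "\<bar>w - nu\<bar> / 2 \<le> cmod (of_real w - zeta)" by argo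
    have "(w + nu) / 2 \<le> Re (of_real w + zeta)" using Re_zeta w0 nu_pos by simp
    also have "\<dots> \<le> cmod (of_real w + zeta)" by (rule complex_Re_le_cmod)
    finally have 4: "(w + nu) / 2 \<le> cmod (of_real w + zeta)" .
    have "d / 4 \<le> (\<bar>w - nu\<bar> / 2) * ((w + nu) / 2)" using d_le by simp
    also have "\<dots> \<le> cmod (of_real w - zeta) * cmod (of_real w + zeta)"
      using 3 4 w0 nu_pos by (intro mult_mono) auto
    also have "\<dots> = cmod (of_real (k\<^sup>2 - q\<^sup>2) - zeta\<^sup>2)"
      unfolding wsq norm_mult[symmetric] by (simp add: algebra_simps power2_eq_square)
    finally show ?thesis .
  qed
  have "cmod (pole k) \<le> 2 * nu / a * (k + 2 * q) / (q * cmod (of_real (k\<^sup>2 - q\<^sup>2) - zeta\<^sup>2))"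
    by (rule norm_pole[OF kpos])
  also have "\<dots> \<le> 2 * nu / a * (3 * k) / (q * (d / 4))"
    using zd d_pos k q_pos nu_pos a_pos by (intro frac_le mult_left_mono mult_nonneg_nonneg mult_pos_pos) auto
  finally have "cmod (pole k) * cmod (cos (zeta * of_real x)) \<le> 2 * nu / a * (3 * k) / (q * (d / 4)) * 2"
    using norm_cos_zeta_x[OF x] nu_pos kpos a_pos q_pos d_pos by (intro mult_mono) auto
  also have "\<dots> = 48 * nu * k / (a * q * d)" by simp
  finally have pole: "cmod (pole k * cos (zeta * of_real x)) \<le> 48 * nu * k / (a * q * d)"
    by (simp add: norm_mult)
  have "cmod (cos (ktilde lam (of_real k) * of_real x)) \<le> 1"
    unfolding ktilde_above[OF k] by (simp add: cos_of_real flip: of_real_mult)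
  then have c1: "cmod (cos (ktilde lam (of_real k) * of_real x) / F a lam (of_real k)) \<le> 1 / cmod (F a lam (of_real k))"
    by (simp add: norm_divide divide_right_mono)
  have D: "cmod (phi a lam k x - eta a lam n k * gamow a lam n x)
      \<le> 1 / cmod (F a lam (of_real k)) + 48 * nu * k / (a * q * d)"
    using norm_phi_minus_gamow[OF x, of k] c1 pole
      norm_triangle_ineq4[of "cos (ktilde lam (of_real k) * of_real x) / F a lam (of_real k)" "pole k * cos (zeta * of_real x)"]
    by linarith
  \<comment> \<open>The bound for the pole grows with \<open>k\<close>. The Jacobian
    \<open>w / k\<close> exchanges this \<open>k\<close> for \<open>w\<close>, and
    \<open>w / d\<close> is bounded because \<open>d\<close> is quadratic in \<open>M\<close> while
    \<open>w\<close> is at most linear.\<close>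
  have "w / d \<le> (M * period) / d"
    using m(2) d_pos by (intro divide_right_mono) (auto simp: w_def M_def)
  also have "\<dots> = 2 * (real n + 3) / (M * period)"
    using M period_pos by (simp add: d_def power2_eq_square)
  also have "\<dots> \<le> 2 * (real n + 3) / (1 * period)"
    using M period_pos by (intro divide_left_mono mult_right_mono) auto
  also have "\<dots> = 2 / pi * ((real n + 3) * a)" by (simp add: period_def)
  also have "\<dots> \<le> 1 * ((real n + 3) * a)" using pi_ge_two a_pos by (intro mult_right_mono) auto
  finally have wd: "w / d \<le> (real n + 3) * a" by simp
  have "w / k * error_density x k
      \<le> w / k * (2 * nu / d * (1 / cmod (F a lam (of_real k)) + 48 * nu * k / (a * q * d)))"
    unfolding error_density_def using psi D w0 kpos nu_pos d_pos by (intro mult_left_mono mult_mono) auto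
  also have "\<dots> = 2 * nu / d * (w / k * (1 / cmod (F a lam (of_real k))) + 48 * nu / (a * q) * (w / d))"
  proof -
    have "w / k * (2 * nu / d * (X + 48 * nu * k / (a * q * d))) = 2 * nu / d * (w / k * X + 48 * nu / (a * q) * (w / d))" for X
      using kpos d_pos a_pos q_pos by (simp add: field_simps)
    then show ?thesis .
  qed
  also have "\<dots> = 2 * nu / d * (weight w + 48 * nu / (a * q) * (w / d))"
    by (simp only: weight_eq[OF k, folded w_def])
  also have "\<dots> \<le> 2 * nu / d * (weight w + 48 * nu / (a * q) * ((real n + 3) * a))"
    using wd nu_pos d_pos a_pos q_pos by (intro mult_left_mono add_left_mono) auto
  also have "\<dots> = 2 * nu / d * (weight w + 48 * nu * (real n + 3) * (1 / q))"
    using a_pos by simp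
  also have "\<dots> \<le> 2 * nu / d * ((1 + 48 * nu * (real n + 3)) * (weight w + 1 / q))"
  proof -
    have "0 \<le> weight w" using w0 by (simp add: weight_def)
    then show ?thesis using nu_pos d_pos q_pos by (intro mult_left_mono) (auto simp: algebra_simps)
  qed
  also have "2 * nu / d = 4 * nu * (real n + 3) / period\<^sup>2 / (real m + 1)\<^sup>2"
  proof -
    have "2 * nu / (X * Y / (2 * N)) = 4 * nu * N / Y / X" for X Y N :: real by (simp add: mult_ac)
    then show ?thesis unfolding d_def M_def by blast
  qed
  finally show ?thesis unfolding w_def by (simp only: mult_ac times_divide_eq_left times_divide_eq_right)
qed


section \<open>The period that contains the resonance\<close>

lemma norm_F_resonant_ge:
  assumes k: "q \<le> k" "k \<le> 2 * q"
    and m: "real m * period \<le> kap k" "kap k \<le> (real m + 1) * period" "n = Suc (2 * m)"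
  shows "nu / q + a * cmod (of_real (kap k) - zeta) \<le> 56 * cmod (F a lam (of_real k))"
proof -
  define w f where "w = kap k" and "f = cmod (F a lam (of_real k))"
  have kpos: "0 < k" using k q_pos by linarith
  have w0: "0 \<le> w" unfolding w_def by (rule kap_nonneg[OF k(1)])
  have f0: "0 \<le> f" by (simp add: f_def)
  have sq: "(k * f)\<^sup>2 = w\<^sup>2 + (q * \<bar>cos (w * a)\<bar>)\<^sup>2"
    using norm_F_above[OF k(1)] by (simp add: f_def w_def power_mult_distrib)
  have "w\<^sup>2 \<le> (k * f)\<^sup>2" "(q * \<bar>cos (w * a)\<bar>)\<^sup>2 \<le> (k * f)\<^sup>2" unfolding sq by auto
  then have le: "w \<le> k * f" "q * \<bar>cos (w * a)\<bar> \<le> k * f"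
    using kpos f0 by (auto intro: power2_le_imp_le)
  have kf: "k * f \<le> 2 * q * f" using k f0 by (intro mult_right_mono) auto
  have w_le: "w \<le> 2 * q * f" using le kf by linarith
  have "q * \<bar>cos (w * a)\<bar> \<le> q * (2 * f)" using le kf by (simp add: mult_ac)
  then have "\<bar>cos (w * a)\<bar> \<le> 2 * f" using q_pos by simp
  then have cos_le: "a * \<bar>w - nu\<bar> \<le> 4 * f"
    using abs_cos_ge[OF m(1,2)] nu_eq_centre[OF m(3)] by (simp add: w_def)
  \<comment> \<open>The two terms of \<open>(k * f)\<^sup>2\<close> are never small together: either
    \<open>w\<close> is comparable to \<open>nu\<close>, or \<open>w\<close> is far from the zero
    \<open>nu\<close> of the cosine.\<close>
  have nu_f: "nu / q \<le> 4 * f"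
  proof (cases "nu / 2 \<le> w")
    case True
    then show ?thesis using w_le q_pos by (simp add: field_simps)
  next
    case False
    then have "nu / 2 \<le> \<bar>w - nu\<bar>" by linarith
    then have "a * (nu / 2) \<le> a * \<bar>w - nu\<bar>" using a_pos by (intro mult_left_mono) auto
    then have "1 / 2 \<le> 4 * f" using cos_le nu_a_ge by (simp add: mult.commute)
    moreover have "nu / q \<le> 1 / 2" using q_ge q_pos by (simp add: field_simps)
    ultimately show ?thesis by linarith
  qed
  have "cmod (of_real w - zeta) \<le> \<bar>w - nu\<bar> + 12 * nu / (a * q)"
    using norm_triangle_ineq4[of "of_real w - of_real nu" "zeta - of_real nu"] zeta_near
      norm_of_real[of "w - nu", where 'a = complex] by simp
  then have "a * cmod (of_real w - zeta) \<le> a * (\<bar>w - nu\<bar> + 12 * nu / (a * q))"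
    using a_pos by (intro mult_left_mono) auto
  \<comment> \<open>The total is \<open>13 * (nu / q) + a * \<bar>w - nu\<bar>\<close>, whence
    \<open>56 = 13 * 4 + 4\<close>.\<close>
  also have "\<dots> = a * \<bar>w - nu\<bar> + 12 * (nu / q)" using a_pos by (simp add: algebra_simps)
  finally show ?thesis using cos_le nu_f by (simp add: w_def f_def)
qed

text \<open>The differences of squares in the energy and in the wave number agree. The sum of the
  energies is at least \<open>q\<close> and the sum of the wave numbers at most
  \<open>4 * nu\<close>, so energies lie closer together by a factor of order
  \<open>nu / q\<close>.\<close>

lemma norm_k_minus_res:
  assumes "q \<le> k" "kap k \<le> 2 * nu"
  shows "cmod (of_real k - res) \<le> 4 * nu / q * cmod (of_real (kap k) - zeta)"
proof -
  have "(of_real k - res) * (of_real k + res) = of_real (k\<^sup>2 - q\<^sup>2) - zeta\<^sup>2"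
    using res_sq by (simp add: algebra_simps flip: power2_eq_square)
  also have "\<dots> = (of_real (kap k) - zeta) * (of_real (kap k) + zeta)"
    unfolding kap_sq[OF assms(1), symmetric] by (simp add: algebra_simps power2_eq_square)
  finally have eq: "cmod (of_real k - res) * cmod (of_real k + res)
      = cmod (of_real (kap k) - zeta) * cmod (of_real (kap k) + zeta)"
    by (simp flip: norm_mult)
  have "cmod (of_real (kap k) + zeta) \<le> 4 * nu"
    using norm_triangle_ineq[of "of_real (kap k)" zeta] norm_zeta assms kap_nonneg[OF assms(1)] nu_pos by simp
  then have "cmod (of_real (kap k) - zeta) * cmod (of_real (kap k) + zeta)
      \<le> cmod (of_real (kap k) - zeta) * (4 * nu)" by (intro mult_left_mono) auto
  moreover have "cmod (of_real k - res) * q \<le> cmod (of_real k - res) * cmod (of_real k + res)"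
    using norm_k_plus_res[OF assms(1)] by (intro mult_left_mono) auto
  ultimately have "cmod (of_real k - res) * q \<le> cmod (of_real (kap k) - zeta) * (4 * nu)"
    using eq by linarith
  then show ?thesis using q_pos by (simp add: field_simps)
qed

text \<open>\<open>F\<close> and \<open>1 / pole\<close> have the same linear approximation at \<open>zeta\<close>. The error terms of order
  \<open>\<bar>\<delta>\<bar> / q\<close> need not be resolved, because \<open>norm_F_resonant_ge\<close> bounds \<open>\<bar>F\<bar>\<close> from below by a multiple
  of \<open>\<bar>\<delta>\<bar> + 1 / q\<close>.\<close>

lemma F_linear:
  assumes k: "q \<le> k" "kap k \<le> 2 * nu"
  defines "\<delta> \<equiv> of_real (kap k) - zeta"
  shows "cmod (F a lam (of_real k) + of_real (a * sg) * \<delta>) \<le> cmod \<delta> * (7 * (nu * a) / q + 2 * a\<^sup>2 * cmod \<delta>)"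
proof -
  define w s c where "w = kap k" and "s = sin (zeta * of_real a)" and "c = cos (zeta * of_real a)"
  have kpos: "0 < k" using k q_pos by linarith
  have w0: "0 \<le> w" unfolding w_def by (rule kap_nonneg[OF k(1)])
  let ?C = "cos (of_real w * of_real a) :: complex" and ?S = "sin (of_real w * of_real a) :: complex"
  have s_eq: "s = of_real sg * res / of_real q" and c_eq: "c = \<i> * of_real sg * zeta / of_real q"
    unfolding s_def c_def by (rule sin_cos_zeta_a)+
  have \<delta>: "\<delta> = of_real w - zeta" by (simp add: \<delta>_def w_def)
  have Im: "\<bar>Im (zeta * of_real a)\<bar> \<le> 1" using Im_zeta_x_small[of a] a_pos by simp
  have Im': "\<bar>Im (of_real w * of_real a :: complex)\<bar> \<le> 1" by simp
  \<comment> \<open>\<open>t1\<close> is the Taylor remainder of the cosine and \<open>t2\<close>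
    replaces \<open>sin (zeta * a)\<close> by its limit \<open>sg\<close>. The zero of
    \<open>F\<close> at \<open>res\<close> expresses \<open>c\<close> through \<open>s\<close>;
    \<open>t3\<close> and \<open>t4\<close> record the change of the sine term and of the
    denominator from \<open>res\<close> to \<open>k\<close>.\<close>
  define t1 t2 t3 t4 where "t1 = ?C - c + s * (\<delta> * of_real a)" and "t2 = (of_real sg - s) * (\<delta> * of_real a)"
    and "t3 = (\<delta> * ?S + zeta * (?S - s)) / of_real k"
    and "t4 = zeta * of_real sg * (of_real k - res) / (of_real k * of_real q)"
  have "F a lam (of_real k) = ?C - \<i> * (of_real w / of_real k) * ?S"
    using ktilde_above[OF k(1)] by (simp add: F_def w_def)
  moreover have "c = \<i> * (zeta * s) / of_real k + \<i> * t4"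
    unfolding c_eq s_eq t4_def using kpos q_pos by (simp add: field_simps)
  ultimately have "F a lam (of_real k) + of_real (a * sg) * \<delta> = t1 + t2 - \<i> * t3 + \<i> * t4"
    unfolding t1_def t2_def t3_def using kpos by (simp add: \<delta> field_simps)
  then have tri: "cmod (F a lam (of_real k) + of_real (a * sg) * \<delta>) \<le> cmod t1 + cmod t2 + cmod t3 + cmod t4"
    using norm_triangle_ineq[of "t1 + t2 - \<i> * t3" "\<i> * t4"] norm_triangle_ineq4[of "t1 + t2" "\<i> * t3"]
      norm_triangle_ineq[of t1 t2] by (simp add: norm_mult)
  have \<delta>a: "of_real w * of_real a - zeta * of_real a = \<delta> * of_real a" by (simp add: \<delta> algebra_simps)
  have "cmod t1 \<le> 2 * (cmod (\<delta> * of_real a))\<^sup>2"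
    using norm_cos_taylor_strip[OF Im' Im] unfolding \<delta>a t1_def c_def s_def .
  then have t1: "cmod t1 \<le> cmod \<delta> * (2 * a\<^sup>2 * cmod \<delta>)"
    by (simp add: norm_mult power_mult_distrib power2_eq_square mult_ac)
  have "of_real sg - s = - of_real sg * ((res - of_real q) / of_real q)"
    using q_pos by (simp add: s_eq field_simps)
  then have "cmod (of_real sg - s) = cmod (res - of_real q) / q"
    using abs_sg q_pos by (simp add: norm_mult norm_divide)
  also have "\<dots> \<le> 2 * nu / q" using norm_res_minus_q q_pos by (intro divide_right_mono) auto
  finally have "cmod t2 \<le> 2 * nu / q * (cmod \<delta> * a)"
    unfolding t2_def norm_mult using a_pos nu_pos q_pos by (intro mult_mono) auto
  then have t2: "cmod t2 \<le> cmod \<delta> * (2 * (nu * a) / q)" by (simp add: mult_ac)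
  have "cmod ?S \<le> 1" by (simp add: sin_of_real flip: of_real_mult)
  then have "cmod (\<delta> * ?S) \<le> cmod \<delta> * 1" unfolding norm_mult by (intro mult_left_mono) auto
  moreover have "cmod (zeta * (?S - s)) \<le> (1.1 * nu) * (2 * (cmod \<delta> * a))"
    unfolding norm_mult using norm_sin_diff_strip[OF Im' Im] norm_zeta nu_pos a_pos
    unfolding \<delta>a s_def by (intro mult_mono) (auto simp: norm_mult)
  ultimately have "cmod (\<delta> * ?S + zeta * (?S - s)) \<le> cmod \<delta> * 1 + (1.1 * nu) * (2 * (cmod \<delta> * a))"
    using norm_triangle_ineq[of "\<delta> * ?S" "zeta * (?S - s)"] by linarith
  also have "\<dots> \<le> cmod \<delta> * (4 * (nu * a))"
  proof -
    have "(1.1 * nu) * (2 * (cmod \<delta> * a)) = 2.2 * (cmod \<delta> * (nu * a))" by simp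
    moreover have "cmod \<delta> * 1 \<le> cmod \<delta> * (nu * a)" using nu_a_ge by (intro mult_left_mono) auto
    moreover have "cmod \<delta> * (4 * (nu * a)) = 4 * (cmod \<delta> * (nu * a))" by simp
    moreover have "0 \<le> cmod \<delta>" by simp
    ultimately show ?thesis by linarith
  qed
  finally have "cmod t3 \<le> cmod \<delta> * (4 * (nu * a)) / k"
    unfolding t3_def norm_divide using kpos by (simp add: divide_right_mono)
  also have "\<dots> \<le> cmod \<delta> * (4 * (nu * a)) / q"
    using k q_pos nu_pos a_pos by (intro divide_left_mono) auto
  finally have t3: "cmod t3 \<le> cmod \<delta> * (4 * (nu * a) / q)" by simp
  have "cmod t4 = cmod zeta * cmod (of_real k - res) / (k * q)"
    using abs_sg kpos q_pos by (simp add: t4_def norm_mult norm_divide)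
  also have "\<dots> \<le> (1.1 * nu) * (4 * nu / q * cmod \<delta>) / (q * q)"
    using norm_k_minus_res[OF k] norm_zeta nu_pos q_pos k
    by (intro frac_le mult_mono) (auto simp: \<delta>_def)
  also have "\<dots> = cmod \<delta> * (4.4 * (nu / q)\<^sup>2 / q)" by (simp add: power2_eq_square mult_ac)
  also have "\<dots> \<le> cmod \<delta> * ((nu * a) / q)"
  proof -
    have "nu / q \<le> 0.1" using q_ge q_pos nu_pos by (simp add: field_simps)
    then have "(nu / q)\<^sup>2 \<le> 0.1\<^sup>2" using nu_pos q_pos by (intro power_mono) auto
    then have "4.4 * (nu / q)\<^sup>2 \<le> nu * a" using nu_a_ge by (simp add: power2_eq_square)
    then show ?thesis using q_pos by (intro mult_left_mono divide_right_mono) auto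
  qed
  finally have t4: "cmod t4 \<le> cmod \<delta> * ((nu * a) / q)" .
  have "cmod \<delta> * (2 * a\<^sup>2 * cmod \<delta>) + cmod \<delta> * (2 * (nu * a) / q) + cmod \<delta> * (4 * (nu * a) / q) + cmod \<delta> * ((nu * a) / q)
      = cmod \<delta> * (7 * (nu * a) / q + 2 * a\<^sup>2 * cmod \<delta>)"
    by (simp add: algebra_simps)
  then show ?thesis using tri t1 t2 t3 t4 by linarith
qed

text \<open>\<open>1 / pole k\<close> factors exactly as \<open>\<delta> * P * A * B\<close>. Here
  \<open>P\<close> is near \<open>- a * sg\<close>, while \<open>A\<close> and \<open>B\<close>
  equal 1 at the resonance and differ from 1 by at most \<open>a * cmod \<delta>\<close>.\<close>

lemma pole_linear:
  assumes k: "q \<le> k" "k \<le> 2 * q" "kap k \<le> 2 * nu"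
  defines "\<delta> \<equiv> of_real (kap k) - zeta"
  shows "cmod (1 / pole k + of_real (a * sg) * \<delta>) \<le> cmod \<delta> * (24 * (nu * a) / q + 5 * a\<^sup>2 * cmod \<delta>)"
    and "a * cmod \<delta> / 6 \<le> cmod (1 / pole k)"
proof -
  define w where "w = kap k"
  define A where "A = (of_real w + zeta) / (2 * zeta)"
  define B where "B = 2 * res / (of_real k + res)"
  have kpos: "0 < k" using k q_pos by linarith
  have w0: "0 \<le> w" unfolding w_def by (rule kap_nonneg[OF k(1)])
  have \<delta>: "\<delta> = of_real w - zeta" by (simp add: \<delta>_def w_def)
  have kr: "q \<le> cmod (of_real k + res)" "cmod (of_real k + res) \<le> 4 * q"
    using norm_k_plus_res[OF k(1)] norm_triangle_ineq[of "of_real k" res] norm_res k kpos by auto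
  then have kr0: "of_real k + res \<noteq> 0" using q_pos by auto
  have eq: "of_real (k\<^sup>2 - q\<^sup>2) - zeta\<^sup>2 = \<delta> * (of_real w + zeta)"
    unfolding kap_sq[OF k(1), symmetric] by (simp add: \<delta> w_def algebra_simps power2_eq_square)
  have "1 / (zeta * K / (P * res * (\<delta> * Y))) = \<delta> * P * (Y / (2 * zeta)) * (2 * res / K)" if "K \<noteq> 0" for K Y
    using zeta_nonzero res_nonzero that by (simp add: field_simps)
  then have inv: "1 / pole k = \<delta> * P * A * B"
    unfolding pole_eq[OF kpos] eq A_def B_def using kr0 by blast
  have wz: "0.9 * nu \<le> cmod (of_real w + zeta)" "cmod (of_real w + zeta) \<le> 3.1 * nu"
    using complex_Re_le_cmod[of "of_real w + zeta"] norm_triangle_ineq[of "of_real w" zeta]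
      Re_zeta norm_zeta w0 k(3) by (auto simp: w_def)
  have A_le: "cmod A \<le> 2"
  proof -
    have "cmod A \<le> (3.1 * nu) / (2 * (0.9 * nu))"
      unfolding A_def norm_divide norm_mult using wz norm_zeta nu_pos by (intro frac_le) auto
    then show ?thesis using nu_pos by simp
  qed
  have A_ge: "0.4 \<le> cmod A"
  proof -
    have "(0.9 * nu) / (2 * (1.1 * nu)) \<le> cmod A"
      unfolding A_def norm_divide norm_mult using wz norm_zeta nu_pos zeta_nonzero by (intro frac_le) auto
    then show ?thesis using nu_pos by simp
  qed
  have B_le: "cmod B \<le> 4"
  proof -
    have "cmod B \<le> (2 * (2 * q)) / q"
      unfolding B_def norm_divide norm_mult using kr norm_res q_pos by (intro frac_le) auto
    then show ?thesis using q_pos by simp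
  qed
  have B_ge: "0.5 \<le> cmod B"
  proof -
    have "(2 * q) / (4 * q) \<le> cmod B"
      unfolding B_def norm_divide norm_mult using kr kr0 norm_res q_pos by (intro frac_le) auto
    then show ?thesis using q_pos by simp
  qed
  have "(0.9 * a) * 0.4 * 0.5 \<le> cmod P * cmod A * cmod B"
    using norm_P A_ge B_ge a_pos by (intro mult_mono) auto
  then have "cmod \<delta> * ((0.9 * a) * 0.4 * 0.5) \<le> cmod \<delta> * (cmod P * cmod A * cmod B)"
    by (intro mult_left_mono) auto
  also have "\<dots> = cmod (1 / pole k)" unfolding inv by (simp add: norm_mult)
  finally have "18 / 100 * (a * cmod \<delta>) \<le> cmod (1 / pole k)" by (simp add: mult_ac)
  moreover have "0 \<le> a * cmod \<delta>" using a_pos by simp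
  ultimately show "a * cmod \<delta> / 6 \<le> cmod (1 / pole k)" by linarith
  have A1: "cmod (A - 1) \<le> a * cmod \<delta>"
  proof -
    have "A - 1 = \<delta> / (2 * zeta)" unfolding A_def \<delta> using zeta_nonzero by (simp add: field_simps)
    then have "cmod (A - 1) \<le> cmod \<delta> / nu"
      unfolding norm_divide norm_mult using norm_zeta nu_pos
      by (auto simp: norm_divide norm_mult intro!: divide_left_mono mult_pos_pos)
    also have "\<dots> \<le> a * cmod \<delta>"
      using mult_right_mono[OF nu_a_ge, of "cmod \<delta>"] nu_pos by (simp add: field_simps)
    finally show ?thesis .
  qed
  have B1: "cmod (B - 1) \<le> a * cmod \<delta>"
  proof -
    have "B - 1 = - (of_real k - res) / (of_real k + res)" unfolding B_def using kr0 by (simp add: field_simps)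
    then have "cmod (B - 1) = cmod (of_real k - res) / cmod (of_real k + res)"
      by (simp add: norm_divide norm_minus_commute)
    also have "\<dots> \<le> (4 * nu / q * cmod \<delta>) / q"
      using norm_k_minus_res[OF k(1,3)] kr q_pos nu_pos by (intro frac_le) (auto simp: \<delta>_def)
    also have "\<dots> = (4 * nu / q) * (1 / q) * cmod \<delta>" by simp
    also have "\<dots> \<le> 1 * a * cmod \<delta>"
      using q_ge q_pos aq_ge a_pos nu_pos by (intro mult_right_mono mult_mono) (auto simp: field_simps)
    finally show ?thesis by simp
  qed
  have "A * B - 1 = (A - 1) * B + (B - 1)" by (simp add: algebra_simps)
  then have "cmod (A * B - 1) \<le> cmod (A - 1) * cmod B + cmod (B - 1)"
    by (metis norm_mult norm_triangle_ineq)
  also have "\<dots> \<le> (a * cmod \<delta>) * 4 + a * cmod \<delta>"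
    using A1 B1 B_le a_pos by (intro add_mono mult_mono) auto
  finally have AB1: "cmod (A * B - 1) \<le> 5 * (a * cmod \<delta>)" by simp
  have "cmod (P + of_real (a * sg)) * (cmod A * cmod B) \<le> 3 * (nu * a) / q * (2 * 4)"
    using P_near A_le B_le nu_pos a_pos q_pos by (intro mult_mono) auto
  moreover have "cmod (of_real (a * sg)) * cmod (A * B - 1) \<le> a * (5 * (a * cmod \<delta>))"
    using AB1 a_pos abs_sg by (simp add: norm_mult)
  moreover have "cmod ((P + of_real (a * sg)) * (A * B) - of_real (a * sg) * (A * B - 1))
      \<le> cmod (P + of_real (a * sg)) * (cmod A * cmod B) + cmod (of_real (a * sg)) * cmod (A * B - 1)"
    by (metis norm_mult norm_triangle_ineq4)
  ultimately have "cmod ((P + of_real (a * sg)) * (A * B) - of_real (a * sg) * (A * B - 1))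
      \<le> 24 * (nu * a) / q + 5 * a\<^sup>2 * cmod \<delta>"
    by (simp add: power2_eq_square)
  moreover have "1 / pole k + of_real (a * sg) * \<delta>
      = \<delta> * ((P + of_real (a * sg)) * (A * B) - of_real (a * sg) * (A * B - 1))"
    unfolding inv by (simp add: algebra_simps)
  ultimately show "cmod (1 / pole k + of_real (a * sg) * \<delta>) \<le> cmod \<delta> * (24 * (nu * a) / q + 5 * a\<^sup>2 * cmod \<delta>)"
    by (simp add: norm_mult mult_left_mono)
qed

text \<open>With \<open>D = 1 / pole k\<close>, the difference \<open>1 / f - pole k\<close> is
  \<open>(D - f) / (D * f)\<close>. The numerator is at most
  \<open>31 * a * cmod \<delta> * (nu / q + a * cmod \<delta>)\<close>, and each factor is matched
  by one of the denominator: \<open>a * cmod \<delta> \<le> 6 * cmod D\<close>, and the sum is at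
  most \<open>56 * cmod f\<close>. This gives \<open>10416 = 6 * 31 * 56\<close>. Exchanging
  \<open>cos (zeta * x)\<close> for \<open>cos (w * x)\<close> costs \<open>pole k\<close> times a
  multiple of \<open>\<delta>\<close>, again bounded. The remaining \<open>1 / F\<close> comes from
  \<open>psi_hat\<close> and turns into \<open>weight\<close>.\<close>

lemma error_density_at_resonance:
  assumes x: "\<bar>x\<bar> \<le> a" and k: "q \<le> k"
    and m: "real m * period \<le> kap k" "kap k \<le> (real m + 1) * period" "n = Suc (2 * m)"
  shows "kap k / k * error_density x k \<le> 22000 * a * weight (kap k)"
proof -
  define w f \<delta> D where "w = kap k" and "f = F a lam (of_real k)"
    and "\<delta> = of_real (kap k) - zeta" and "D = 1 / pole k"
  have kpos: "0 < k" using k q_pos by linarith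
  have w0: "0 \<le> w" unfolding w_def by (rule kap_nonneg[OF k])
  have "(real m + 1) * period \<le> 2 * centre m" using period_pos by (simp add: centre_def algebra_simps)
  then have w_le: "kap k \<le> 2 * nu" using m(2) nu_eq_centre[OF m(3)] by linarith
  have "k\<^sup>2 = q\<^sup>2 + (kap k)\<^sup>2" by (simp add: kap_sq[OF k])
  also have "\<dots> \<le> q\<^sup>2 + q\<^sup>2"
    using w_le q_ge nu_pos kap_nonneg[OF k] by (intro add_left_mono power_mono) auto
  also have "\<dots> \<le> (2 * q)\<^sup>2" by (simp add: power2_eq_square)
  finally have k2: "k \<le> 2 * q" by (rule power2_le_imp_le) (use q_pos in simp)
  have \<delta>0: "0 < cmod \<delta>" using Im_zeta_neg by (auto simp: \<delta>_def complex_eq_iff)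
  have D_ge: "a * cmod \<delta> / 6 \<le> cmod D" unfolding D_def \<delta>_def by (rule pole_linear(2)[OF k k2 w_le])
  have D0: "0 < cmod D" using D_ge \<delta>0 a_pos by (smt (verit) divide_pos_pos mult_pos_pos)
  have f0: "0 < cmod f" unfolding f_def by (rule norm_F_pos[OF kpos])
  have "cmod (D - f) \<le> cmod (D + of_real (a * sg) * \<delta>) + cmod (f + of_real (a * sg) * \<delta>)"
    using norm_triangle_ineq4[of "D + of_real (a * sg) * \<delta>" "f + of_real (a * sg) * \<delta>"] by simp
  also have "\<dots> \<le> cmod \<delta> * (24 * (nu * a) / q + 5 * a\<^sup>2 * cmod \<delta>) + cmod \<delta> * (7 * (nu * a) / q + 2 * a\<^sup>2 * cmod \<delta>)"
    unfolding D_def f_def \<delta>_def by (intro add_mono pole_linear(1) F_linear k k2 w_le)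
  also have "\<dots> = a * cmod \<delta> * (31 * (nu / q) + 7 * (a * cmod \<delta>))"
    by (simp add: algebra_simps power2_eq_square)
  also have "\<dots> \<le> a * cmod \<delta> * (31 * (nu / q + a * cmod \<delta>))"
    using a_pos nu_pos q_pos by (intro mult_left_mono) auto
  also have "\<dots> \<le> a * cmod \<delta> * (31 * (56 * cmod f))"
    unfolding f_def \<delta>_def using a_pos norm_F_resonant_ge[OF k k2 m] by (intro mult_left_mono) auto
  also have "\<dots> \<le> (6 * cmod D) * (31 * (56 * cmod f))"
    using D_ge f0 by (intro mult_right_mono) auto
  finally have Df: "cmod (D - f) \<le> 10416 * (cmod D * cmod f)" by simp
  have "1 / f - pole k = (D - f) / (D * f)"
    using D0 f0 by (simp add: D_def field_simps)
  then have inv: "cmod (1 / f - pole k) \<le> 10416"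
    using Df D0 f0 by (simp add: norm_divide norm_mult pos_divide_le_eq)
  have cx: "cmod (cos (of_real w * of_real x)) \<le> 1" by (simp add: cos_of_real flip: of_real_mult)
  have "cmod (cos (of_real w * of_real x) - cos (zeta * of_real x)) \<le> 2 * cmod (of_real w * of_real x - zeta * of_real x)"
    by (intro norm_cos_diff_strip Im_zeta_x_small x) simp
  also have "of_real w * of_real x - zeta * of_real x = \<delta> * of_real x" by (simp add: \<delta>_def w_def algebra_simps)
  also have "2 * cmod (\<delta> * of_real x) \<le> 2 * (cmod \<delta> * a)" using x by (simp add: norm_mult mult_left_mono)
  also have "\<dots> \<le> 12 * cmod D" using D_ge by (simp add: mult.commute)
  finally have "cmod (cos (of_real w * of_real x) - cos (zeta * of_real x)) / cmod D \<le> 12"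
    using D0 by (simp add: field_simps)
  then have cd: "cmod (pole k * (cos (of_real w * of_real x) - cos (zeta * of_real x))) \<le> 12"
    by (simp add: D_def norm_mult norm_divide mult.commute)
  have "cos (ktilde lam (of_real k) * of_real x) / f - pole k * cos (zeta * of_real x)
     = cos (of_real w * of_real x) * (1 / f - pole k) + pole k * (cos (of_real w * of_real x) - cos (zeta * of_real x))"
    unfolding ktilde_above[OF k] w_def by (simp add: algebra_simps)
  then have "cmod (cos (ktilde lam (of_real k) * of_real x) / f - pole k * cos (zeta * of_real x))
     \<le> cmod (cos (of_real w * of_real x)) * cmod (1 / f - pole k) + cmod (pole k * (cos (of_real w * of_real x) - cos (zeta * of_real x)))"
    by (metis norm_mult norm_triangle_ineq)
  also have "\<dots> \<le> 1 * 10416 + 12" using cx inv cd by (intro add_mono mult_mono) auto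
  finally have "cmod (phi a lam k x - eta a lam n k * gamow a lam n x) \<le> 11000"
    using norm_phi_minus_gamow[OF x, of k] unfolding f_def by linarith
  then have "w / k * error_density x k \<le> w / k * (2 * a / cmod f * 11000)"
    unfolding error_density_def f_def using norm_psi_hat_above[OF k] w0 kpos a_pos
    by (intro mult_left_mono mult_mono) auto
  also have "\<dots> = 22000 * a * (w / k * (1 / cmod f))" by simp
  also have "\<dots> = 22000 * a * weight w" unfolding w_def f_def weight_eq[OF k] ..
  finally show ?thesis unfolding w_def .
qed


subsection \<open>Integration over the wave number\<close>

lemma weight_le_one:
  assumes "0 \<le> w"
  shows "weight w \<le> 1"
proof -
  define S where "S = sqrt (w\<^sup>2 + q\<^sup>2 * (cos (w * a))\<^sup>2)"
  have "w \<le> S" unfolding S_def by (rule real_le_rsqrt) simp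
  then have "w / S \<le> S / S" using assms by (intro divide_right_mono) auto
  also have "\<dots> \<le> 1" by simp
  finally show ?thesis by (simp add: weight_def S_def)
qed

lemma weight_away_from_centre:
  assumes m: "real m * period \<le> w" "w \<le> (real m + 1) * period"
    and s: "0 < s" "s\<^sup>2 = (real m + 1) / q" "s < \<bar>w - centre m\<bar>"
  shows "weight w \<le> 2 * period / a * s"
proof -
  have w0: "0 \<le> w" using m(1) period_pos by (meson mult_nonneg_nonneg of_nat_0_le_iff less_imp_le order_trans)
  have "a * s / 2 \<le> a * \<bar>w - centre m\<bar> / 2" using s(3) a_pos by simp
  also have "\<dots> \<le> \<bar>cos (w * a)\<bar>" by (rule abs_cos_ge[OF m])
  finally have "a * s / 2 \<le> \<bar>cos (w * a)\<bar>" .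
  then have "q * (a * s / 2) \<le> q * \<bar>cos (w * a)\<bar>" using q_pos by simp
  also have "\<dots> \<le> sqrt (w\<^sup>2 + q\<^sup>2 * (cos (w * a))\<^sup>2)"
    by (rule real_le_rsqrt) (simp add: power_mult_distrib)
  finally have S: "q * (a * s / 2) \<le> sqrt (w\<^sup>2 + q\<^sup>2 * (cos (w * a))\<^sup>2)" .
  have "0 < q * (a * s / 2)" using q_pos a_pos s(1) by simp
  then have "weight w \<le> w / (q * (a * s / 2))"
    unfolding weight_def using S w0 by (intro frac_le) auto
  also have "\<dots> \<le> ((real m + 1) * period) / (q * (a * s / 2))"
    using m(2) q_pos a_pos s(1) by (intro divide_right_mono) auto
  also have "\<dots> = 2 * period / a * (s\<^sup>2 / s)"
    unfolding s(2) using q_pos a_pos s(1) by (simp add: field_simps)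
  also have "\<dots> = 2 * period / a * s" by (simp add: power2_eq_square)
  finally show ?thesis .
qed

text \<open>The constants off and at the resonance, added. The factor \<open>(n + 1)\<^sup>2\<close>
  compensates the division by \<open>(m + 1)\<^sup>2\<close> in the resonant period, where
  \<open>m < n\<close>.\<close>

definition density_const :: real where
  "density_const = 4 * nu * (real n + 3) / period\<^sup>2 * (1 + 48 * nu * (real n + 3)) + 22000 * a * (real n + 1)\<^sup>2"

lemma density_const_nonneg: "0 \<le> density_const"
  using nu_pos a_pos by (simp add: density_const_def)

lemma error_density_above:
  assumes x: "\<bar>x\<bar> \<le> a" and k: "q \<le> k"
    and m: "real m * period \<le> kap k" "kap k \<le> (real m + 1) * period"
  shows "kap k / k * error_density x k \<le> density_const / (real m + 1)\<^sup>2 * (weight (kap k) + 1 / q)"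
proof -
  define A B where "A = 4 * nu * (real n + 3) / period\<^sup>2 * (1 + 48 * nu * (real n + 3))"
    and "B = 22000 * a * (real n + 1)\<^sup>2"
  have AB: "0 \<le> A" "0 \<le> B" using nu_pos a_pos by (auto simp: A_def B_def)
  have W: "0 \<le> weight (kap k)" using kap_nonneg[OF k] by (simp add: weight_def)
  have W1: "0 \<le> weight (kap k) + 1 / q" using W q_pos by simp
  have const: "density_const = A + B" by (simp add: density_const_def A_def B_def)
  show ?thesis
  proof (cases "n = Suc (2 * m)")
    case True
    have "22000 * a \<le> B / (real m + 1)\<^sup>2"
    proof -
      have "(real m + 1)\<^sup>2 \<le> (real n + 1)\<^sup>2" using True by (intro power_mono) auto
      then show ?thesis using a_pos by (simp add: B_def pos_le_divide_eq add_nonneg_pos)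
    qed
    also have "\<dots> \<le> density_const / (real m + 1)\<^sup>2"
      using AB by (intro divide_right_mono) (auto simp: const)
    finally have "22000 * a * weight (kap k) \<le> density_const / (real m + 1)\<^sup>2 * (weight (kap k) + 1 / q)"
      using W a_pos q_pos density_const_nonneg by (intro mult_mono) auto
    then show ?thesis using error_density_at_resonance[OF x k m True] by linarith
  next
    case False
    have "A / (real m + 1)\<^sup>2 \<le> density_const / (real m + 1)\<^sup>2"
      using AB by (intro divide_right_mono) (auto simp: const)
    then have "A / (real m + 1)\<^sup>2 * (weight (kap k) + 1 / q) \<le> density_const / (real m + 1)\<^sup>2 * (weight (kap k) + 1 / q)"
      using W1 by (rule mult_right_mono)
    then show ?thesis using error_density_off_resonance[OF x k m False] unfolding A_def by linarith
  qed
qed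

lemma error_density_measurable [measurable]: "error_density x \<in> borel_measurable borel"
  unfolding error_density_def[abs_def] by measurable

definition edge :: "nat \<Rightarrow> real" where "edge m = sqrt (q\<^sup>2 + (real m * period)\<^sup>2)"

text \<open>The interval is split at distance \<open>s = sqrt ((m + 1) / q)\<close> from the peak: inside,
  \<open>weight \<le> 1\<close>; outside, \<open>weight\<close> is itself of order \<open>s\<close>.\<close>

lemma nn_integral_period:
  assumes x: "\<bar>x\<bar> \<le> a"
  shows "(\<integral>\<^sup>+k. ennreal (error_density x k * indicator {edge m..edge (Suc m)} k) \<partial>lborel)
    \<le> ennreal (density_const * (2 + 2 * period\<^sup>2 / a + period) / sqrt q * (real m + 1) powr (-3/2))"
proof -
  define g where "g w = sqrt (q\<^sup>2 + w\<^sup>2)" for w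
  define s where "s = sqrt ((real m + 1) / q)"
  define l r where "l = real m * period" and "r = (real m + 1) * period"
  define K where "K = density_const / (real m + 1)\<^sup>2"
  have K: "0 \<le> K" using density_const_nonneg by (simp add: K_def)
  have s: "0 < s" "s\<^sup>2 = (real m + 1) / q" using q_pos by (simp_all add: s_def add_nonneg_pos)
  \<comment> \<open>Absorbs the \<open>1 / q\<close> left by the pole term into \<open>s\<close>, by
    \<open>1 \<le> q\<close>.\<close>
  have q_s: "1 / q \<le> s"
  proof -
    have "(1 / q)\<^sup>2 \<le> 1 / q" using q_ge q_pos by (simp add: power2_eq_square field_simps)
    also have "\<dots> \<le> (real m + 1) / q" using q_pos by (intro divide_right_mono) auto
    finally show ?thesis unfolding s_def by (rule real_le_rsqrt)
  qed
  have lr: "0 \<le> l" "l \<le> r" "r - l = period" using period_pos by (auto simp: l_def r_def algebra_simps)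
  have pos: "0 < q\<^sup>2 + w\<^sup>2" for w using q_pos by (simp add: add_pos_nonneg)
  have edges: "edge m = g l" "edge (Suc m) = g r" by (simp_all add: edge_def g_def l_def r_def add.commute)
  have "(\<integral>\<^sup>+k. ennreal (error_density x k * indicator {edge m..edge (Suc m)} k) \<partial>lborel)
      = (\<integral>\<^sup>+w. ennreal (error_density x (g w) * (w / g w) * indicator {l..r} w) \<partial>lborel)"
    unfolding edges
  proof (rule nn_integral_substitution)
    show "set_borel_measurable borel {g l..g r} (error_density x)"
      unfolding set_borel_measurable_def by measurable
    show "(g has_real_derivative w / g w) (at w)" for w
      unfolding g_def using pos[of w]
      by (auto intro!: derivative_eq_intros simp: field_simps)
    show "continuous_on {l..r} (\<lambda>w. w / g w)"
      unfolding g_def using pos by (intro continuous_intros) (auto simp: less_le)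
    show "0 \<le> w / g w" if "w \<in> {l..r}" for w using that lr by (simp add: g_def)
  qed (rule lr)
  also have "\<dots> \<le> (\<integral>\<^sup>+w. ennreal K * indicator {centre m - s..centre m + s} w
      + ennreal (K * (2 * period / a * s + s)) * indicator {l..r} w \<partial>lborel)"
  proof (rule nn_integral_mono)
    fix w
    show "ennreal (error_density x (g w) * (w / g w) * indicator {l..r} w)
      \<le> ennreal K * indicator {centre m - s..centre m + s} w
        + ennreal (K * (2 * period / a * s + s)) * indicator {l..r} w"
    proof (cases "w \<in> {l..r}")
      case True
      then have w0: "0 \<le> w" using lr by simp
      have kap: "kap (g w) = w" using w0 by (simp add: kap_def g_def)
      have qg: "q \<le> g w" unfolding g_def by (rule real_le_rsqrt) simp
      have mw: "real m * period \<le> w" "w \<le> (real m + 1) * period" using True by (auto simp: l_def r_def)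
      have "error_density x (g w) * (w / g w) \<le> K * (weight w + 1 / q)"
        using error_density_above[OF x qg, of m] mw unfolding kap K_def by (simp add: mult.commute)
      also have "\<dots> \<le> K * (weight w + s)" using q_s K by (intro mult_left_mono) auto
      finally have *: "error_density x (g w) * (w / g w) \<le> K * (weight w + s)" .
      show ?thesis
      proof (cases "\<bar>w - centre m\<bar> \<le> s")
        case near: True
        have "0 \<le> 2 * period / a * s" using period_pos a_pos s(1) by simp
        then have "K * (weight w + s) \<le> K * (1 + (2 * period / a * s + s))"
          using weight_le_one[OF w0] K by (intro mult_left_mono) linarith+
        then have "error_density x (g w) * (w / g w) \<le> K + K * (2 * period / a * s + s)"
          using * by (simp add: distrib_left)
        then show ?thesis
          using True near K period_pos a_pos s(1) by (auto simp: abs_le_iff ennreal_leI simp flip: ennreal_plus)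
      next
        case False
        then have "weight w \<le> 2 * period / a * s" by (intro weight_away_from_centre[OF mw s]) simp
        then have "K * (weight w + s) \<le> K * (2 * period / a * s + s)" using K by (intro mult_left_mono) auto
        then have "error_density x (g w) * (w / g w) \<le> K * (2 * period / a * s + s)" using * by linarith
        then show ?thesis using True by (simp add: ennreal_leI add_increasing)
      qed
    qed simp
  qed
  also have "\<dots> = ennreal K * emeasure lborel {centre m - s..centre m + s}
      + ennreal (K * (2 * period / a * s + s)) * emeasure lborel {l..r}"
    by (simp add: nn_integral_add nn_integral_cmult_indicator)
  also have "\<dots> = ennreal (K * (2 * s) + K * (2 * period / a * s + s) * period)"
    using K period_pos a_pos s(1) lr by (simp add: ennreal_mult' ennreal_plus)
  also have "K * (2 * s) + K * (2 * period / a * s + s) * period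
      = density_const * (2 + 2 * period\<^sup>2 / a + period) * (s / (real m + 1)\<^sup>2)"
    by (simp add: K_def power2_eq_square algebra_simps add_divide_distrib)
  also have "s / (real m + 1)\<^sup>2 = (real m + 1) powr (-3/2) / sqrt q"
  proof -
    have "s = (real m + 1) powr (1/2) / sqrt q" by (simp add: s_def real_sqrt_divide powr_half_sqrt)
    moreover have "(real m + 1) powr (1/2) / (real m + 1)\<^sup>2 = (real m + 1) powr (1/2 - 2)"
      by (simp only: powr_diff) (simp add: powr_numeral)
    ultimately show ?thesis by (simp add: field_simps)
  qed
  finally show ?thesis by simp
qed

lemma nn_integral_below:
  assumes x: "\<bar>x\<bar> \<le> a"
  shows "(\<integral>\<^sup>+k. ennreal (error_density x k * indicator {0<..q} k) \<partial>lborel) \<le> ennreal (192 * sqrt nu / sqrt q)"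
proof -
  define G where "G k = - (32 * nu / q) * ln (nu\<^sup>2 + q * (q - k))" for k
  have pos: "0 < nu\<^sup>2 + q * (q - k)" if "k \<le> q" for k
    using that nu_pos q_pos by (intro add_pos_nonneg) auto
  have "(\<integral>\<^sup>+k. ennreal (error_density x k * indicator {0<..q} k) \<partial>lborel)
      \<le> (\<integral>\<^sup>+k. ennreal (32 * nu / (nu\<^sup>2 + q * (q - k))) * indicator {0..q} k \<partial>lborel)"
    using error_density_below[OF x]
    by (intro nn_integral_mono) (auto simp: indicator_def ennreal_leI)
  also have "\<dots> = ennreal (G q - G 0)"
  proof (rule nn_integral_FTC_Icc)
    show "(G has_real_derivative 32 * nu / (nu\<^sup>2 + q * (q - k))) (at k)" if "k \<in> {0..q}" for k
    proof -
      have "((\<lambda>k. ln (nu\<^sup>2 + q * (q - k))) has_real_derivative - q / (nu\<^sup>2 + q * (q - k))) (at k)"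
        using pos[of k] that by (auto intro!: derivative_eq_intros)
      from DERIV_cmult[OF this, of "- (32 * nu / q)"] show ?thesis
        using q_pos by (simp add: G_def[abs_def])
    qed
    show "0 \<le> 32 * nu / (nu\<^sup>2 + q * (q - k))" if "k \<in> {0..q}" for k
      using pos[of k] that nu_pos by simp
  qed (use q_pos in auto)
  also have "G q - G 0 \<le> 192 * sqrt nu / sqrt q"
  proof -
    define y where "y = q / nu"
    have y: "1 \<le> y" using q_ge nu_pos by (simp add: y_def field_simps)
    have "ln (nu\<^sup>2 + q\<^sup>2) - ln (nu\<^sup>2) = ln (1 + y\<^sup>2)"
    proof -
      have "1 + y\<^sup>2 = (nu\<^sup>2 + q\<^sup>2) / nu\<^sup>2" using nu_pos by (simp add: y_def power_divide add_divide_distrib)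
      then show ?thesis using nu_pos q_pos by (simp add: ln_div add_pos_pos)
    qed
    \<comment> \<open>The fourth power turns the logarithm into
      \<open>4 * ln (sqrt (1 + y))\<close>, so that \<open>ln u \<le> u\<close> already gives order
      \<open>sqrt y\<close>. With the prefactor \<open>32 / y\<close> this is the required order
      \<open>1 / sqrt y\<close>.\<close>
    also have "ln (1 + y\<^sup>2) \<le> ln ((sqrt (1 + y)) ^ 4)"
    proof (rule ln_mono)
      have "(sqrt (1 + y)) ^ 4 = ((sqrt (1 + y))\<^sup>2)\<^sup>2" by (simp flip: power_mult)
      also have "\<dots> = (1 + y)\<^sup>2" using y by simp
      finally show "1 + y\<^sup>2 \<le> (sqrt (1 + y)) ^ 4" using y by (simp add: power2_sum)
    qed (simp_all add: add_pos_nonneg)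
    also have "\<dots> = 4 * ln (sqrt (1 + y))" using y by (simp add: ln_realpow)
    also have "\<dots> \<le> 4 * sqrt (1 + y)" using ln_bound[of "sqrt (1 + y)"] y by simp
    also have "\<dots> \<le> 4 * sqrt (2 * y)" using y by simp
    also have "\<dots> \<le> 6 * sqrt y"
    proof -
      have "sqrt 2 \<le> 3 / 2" by (rule real_le_lsqrt) (auto simp: power2_eq_square)
      then have "sqrt 2 * sqrt y \<le> 3 / 2 * sqrt y" using y by (intro mult_right_mono) auto
      then show ?thesis by (simp add: real_sqrt_mult mult_ac)
    qed
    finally have ln_le: "ln (nu\<^sup>2 + q\<^sup>2) - ln (nu\<^sup>2) \<le> 6 * sqrt y" .
    have "G q - G 0 = 32 * nu / q * (ln (nu\<^sup>2 + q\<^sup>2) - ln (nu\<^sup>2))"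
      by (simp add: G_def algebra_simps power2_eq_square)
    also have "\<dots> \<le> 32 * nu / q * (6 * sqrt y)"
      using ln_le nu_pos q_pos by (intro mult_left_mono) auto
    also have "\<dots> = 192 * sqrt nu / sqrt q"
    proof -
      have "32 * (u * u) / (v * v) * (6 * (v / u)) = 192 * u / v" if "0 < u" "0 < v" for u v :: real
        using that by simp
      from this[of "sqrt nu" "sqrt q"] show ?thesis
        using nu_pos q_pos by (simp add: y_def real_sqrt_divide)
    qed
    finally show ?thesis .
  qed
  finally show ?thesis by (simp add: ennreal_leI)
qed

definition total_const :: real where
  "total_const = 192 * sqrt nu
     + density_const * (2 + 2 * period\<^sup>2 / a + period) * (\<Sum>m. (real m + 1) powr (-3/2))"

lemma summable_periods: "summable (\<lambda>m. (real m + 1) powr (-3/2))"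
  using summable_real_powr_iff[of "-3/2"] summable_Suc_iff[of "\<lambda>m. real m powr (-3/2)"]
  by (simp add: add.commute)

lemma total_const_nonneg: "0 \<le> total_const"
  unfolding total_const_def using nu_pos density_const_nonneg period_pos a_pos
  by (intro add_nonneg_nonneg mult_nonneg_nonneg suminf_nonneg summable_periods) auto

lemma nn_integral_error_density:
  assumes x: "\<bar>x\<bar> \<le> a"
  shows "(\<integral>\<^sup>+k. ennreal (error_density x k * indicator {0<..} k) \<partial>lborel) \<le> ennreal (total_const / sqrt q)"
proof -
  let ?f = "error_density x"
  define c where "c = density_const * (2 + 2 * period\<^sup>2 / a + period) / sqrt q"
  have c: "0 \<le> c" unfolding c_def using density_const_nonneg period_pos a_pos q_pos by simp
  have "(\<integral>\<^sup>+k. ennreal (?f k * indicator {0<..} k) \<partial>lborel)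
    \<le> (\<integral>\<^sup>+k. ennreal (?f k * indicator {0<..q} k) + (\<Sum>m. ennreal (?f k * indicator {edge m..edge (Suc m)} k)) \<partial>lborel)"
  proof (rule nn_integral_mono)
    fix k
    show "ennreal (?f k * indicator {0<..} k)
      \<le> ennreal (?f k * indicator {0<..q} k) + (\<Sum>m. ennreal (?f k * indicator {edge m..edge (Suc m)} k))"
    proof (cases "q < k")
      case True
      \<comment> \<open>The closed periods share endpoints, so points may be counted twice; this is
        harmless for an upper bound.\<close>
      define m where "m = nat \<lfloor>kap k / period\<rfloor>"
      have "0 \<le> kap k / period" using kap_nonneg[of k] True period_pos by simp
      then have "real m \<le> kap k / period" "kap k / period \<le> real (Suc m)"
        by (simp_all add: m_def) linarith
      then have m: "real m * period \<le> kap k" "kap k \<le> real (Suc m) * period"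
        using period_pos by (simp_all add: field_simps)
      have k_eq: "k = sqrt (q\<^sup>2 + (kap k)\<^sup>2)" using True q_pos by (simp add: kap_sq)
      have "(real m * period)\<^sup>2 \<le> (kap k)\<^sup>2" "(kap k)\<^sup>2 \<le> (real (Suc m) * period)\<^sup>2"
        using m kap_nonneg[of k] True period_pos by (intro power_mono; simp)+
      then have "edge m \<le> sqrt (q\<^sup>2 + (kap k)\<^sup>2)" "sqrt (q\<^sup>2 + (kap k)\<^sup>2) \<le> edge (Suc m)"
        unfolding edge_def by (auto simp del: of_nat_Suc)
      then have "k \<in> {edge m..edge (Suc m)}" using k_eq by simp
      then have "ennreal (?f k * indicator {0<..} k) \<le> ennreal (?f k * indicator {edge m..edge (Suc m)} k)"
        by (simp add: error_density_nonneg indicator_def)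
      also have "\<dots> \<le> (\<Sum>m. ennreal (?f k * indicator {edge m..edge (Suc m)} k))"
        using sum_le_suminf[of "\<lambda>m. ennreal (?f k * indicator {edge m..edge (Suc m)} k)" "{m}"] by simp
      finally show ?thesis by (simp add: add_increasing)
    qed (simp add: indicator_def add_increasing2)
  qed
  also have "\<dots> = (\<integral>\<^sup>+k. ennreal (?f k * indicator {0<..q} k) \<partial>lborel)
      + (\<Sum>m. \<integral>\<^sup>+k. ennreal (?f k * indicator {edge m..edge (Suc m)} k) \<partial>lborel)"
    by (subst nn_integral_add) (auto simp: nn_integral_suminf)
  also have "\<dots> \<le> ennreal (192 * sqrt nu / sqrt q) + (\<Sum>m. ennreal (c * (real m + 1) powr (-3/2)))"
    using nn_integral_below[OF x] nn_integral_period[OF x] unfolding c_def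
    by (intro add_mono suminf_le) auto
  also have "(\<Sum>m. ennreal (c * (real m + 1) powr (-3/2))) = ennreal (\<Sum>m. c * (real m + 1) powr (-3/2))"
    using c by (intro suminf_ennreal2 summable_mult summable_periods) auto
  also have "(\<Sum>m. c * (real m + 1) powr (-3/2)) = c * (\<Sum>m. (real m + 1) powr (-3/2))"
    by (intro suminf_mult summable_periods)
  also have "ennreal (192 * sqrt nu / sqrt q) + ennreal (c * (\<Sum>m. (real m + 1) powr (-3/2))) = ennreal (total_const / sqrt q)"
  proof -
    have "0 \<le> (\<Sum>m. (real m + 1) powr (-3/2))" by (intro suminf_nonneg summable_periods) auto
    then have "0 \<le> c * (\<Sum>m. (real m + 1) powr (-3/2))" using c by simp
    then show ?thesis using nu_pos q_pos
      by (subst ennreal_plus[symmetric]) (auto simp: total_const_def c_def add_divide_distrib)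
  qed
  finally show ?thesis .
qed

lemma norm_E_le:
  assumes x: "\<bar>x\<bar> \<le> a"
  shows "cmod (E a lam n x t) \<le> total_const / sqrt q"
proof -
  let ?g = "\<lambda>k. indicator {0<..} k *\<^sub>R (psi_hat a lam n k * (phi a lam k x - eta a lam n k * gamow a lam n x)
                        * exp (- \<i> * of_real (k\<^sup>2 / 2 * t)))"
  have E: "E a lam n x t = (LBINT k. ?g k)"
    using x by (simp add: E_def set_lebesgue_integral_def indicator_def abs_le_iff)
  show ?thesis
  proof (cases "integrable lborel ?g")
    case True
    have "ennreal (cmod (E a lam n x t)) \<le> (\<integral>\<^sup>+k. ennreal (cmod (?g k)) \<partial>lborel)"
      unfolding E by (rule integral_norm_bound_ennreal[OF True])
    also have "\<dots> = (\<integral>\<^sup>+k. ennreal (error_density x k * indicator {0<..} k) \<partial>lborel)"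
      by (intro nn_integral_cong) (simp add: error_density_def norm_mult indicator_def norm_exp_eq_Re)
    also have "\<dots> \<le> ennreal (total_const / sqrt q)" by (rule nn_integral_error_density[OF x])
    finally show ?thesis using total_const_nonneg q_pos by (simp add: ennreal_le_iff)
  next
    \<comment> \<open>The Bochner integral then takes its default value 0, and the bound is
      nonnegative.\<close>
    case False
    then show ?thesis using total_const_nonneg q_pos unfolding E by (simp add: not_integrable_integral_eq)
  qed
qed

lemma E_in_L2: "in_L2 (\<lambda>x. E a lam n x t)"
  and L2_norm_E_le: "L2_norm (\<lambda>x. E a lam n x t) \<le> sqrt (2 * a) * (total_const / sqrt q)"
proof -
  define c where "c = total_const / sqrt q"
  have c: "0 \<le> c" using total_const_nonneg q_pos by (simp add: c_def)
  have [measurable]: "(\<lambda>x. E a lam n x t) \<in> borel_measurable borel" by (rule E_measurable)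
  have le: "(cmod (E a lam n x t))\<^sup>2 \<le> c\<^sup>2 * indicator {-a..a} x" for x
  proof (cases "\<bar>x\<bar> \<le> a")
    case True
    then show ?thesis using norm_E_le[OF True, of t] by (auto simp: c_def indicator_def intro!: power_mono)
  next
    case False
    then have "x \<notin> {-a..a}" by auto
    then show ?thesis by (simp add: E_def)
  qed
  have int: "integrable lborel (\<lambda>x. c\<^sup>2 * indicator {-a..a} x :: real)"
    by (intro integrable_mult_right integrable_real_indicator) (auto simp: emeasure_lborel_Icc_eq)
  have int2: "integrable lborel (\<lambda>x. (cmod (E a lam n x t))\<^sup>2)"
    by (rule Bochner_Integration.integrable_bound[OF int]) (use le in \<open>auto simp: indicator_def\<close>)
  show "in_L2 (\<lambda>x. E a lam n x t)" using int2 by (simp add: in_L2_def)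
  have "(LBINT x. (cmod (E a lam n x t))\<^sup>2) \<le> (LBINT x. c\<^sup>2 * indicator {-a..a} x)"
    by (rule integral_mono[OF int2 int le])
  also have "\<dots> = 2 * a * c\<^sup>2" using a_pos by simp
  finally have "L2_norm (\<lambda>x. E a lam n x t) \<le> sqrt (2 * a * c\<^sup>2)"
    unfolding L2_norm_def by simp
  also have "\<dots> = sqrt (2 * a) * c" using c by (simp add: real_sqrt_mult)
  finally show "L2_norm (\<lambda>x. E a lam n x t) \<le> sqrt (2 * a) * (total_const / sqrt q)" by (simp add: c_def)
qed

end

section \<open>Threshold and constants of the final estimate\<close>

theorem lemma8:
  fixes a :: real and n :: nat
  assumes "a > 0" and "n \<ge> 1" and "odd n"
  shows "\<exists>C lam0 :: real. C > 0 \<and> lam0 > 0 \<and>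
    (\<forall>lam\<ge>lam0. real n < n_max lam \<longrightarrow>
      (\<forall>t>0. in_L2 (\<lambda>x. E a lam n x t) \<and>
             L2_norm (\<lambda>x. E a lam n x t) \<le> C * lam powr (-1/4)))"
proof -
  define b where "b = max 1 (1000 * (real n * pi / (2 * a)))"
  have b: "barrier a n lam" if "b\<^sup>2 \<le> lam" for lam
  proof -
    have "b \<le> sqrt (2 * lam)" using that zero_le_power2[of b] by (intro real_le_rsqrt) linarith
    then show ?thesis using assms unfolding b_def by unfold_locales auto
  qed
  have b1: "1 \<le> b" by (simp add: b_def)
  \<comment> \<open>\<open>total_const\<close> is built from \<open>a\<close> and \<open>n\<close>
    alone, so its exported form has no argument \<open>lam\<close> and the constant is uniform. Its
    nonnegativity is a fact of the locale and needs one admissible \<open>lam\<close>;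
    \<open>b\<^sup>2\<close> serves.\<close>
  define c where "c = sqrt (2 * a) * barrier.total_const a n"
  have "0 \<le> c" unfolding c_def using barrier.total_const_nonneg[OF b[OF order_refl]] assms by simp
  \<comment> \<open>The constant is \<open>c + 1\<close>, because \<open>C\<close> must be positive
    and \<open>c\<close> is only known to be nonnegative.\<close>
  have "L2_norm (\<lambda>x. E a lam n x t) \<le> (c + 1) * lam powr (-1/4)"
    and "in_L2 (\<lambda>x. E a lam n x t)" if "b\<^sup>2 \<le> lam" for lam t
  proof -
    interpret barrier a n lam by (rule b[OF that])
    show "in_L2 (\<lambda>x. E a lam n x t)" by (rule E_in_L2)
    have "sqrt (sqrt lam) \<le> sqrt q" using lam_pos by (simp add: q_def)
    moreover have "sqrt (sqrt lam) = lam powr (1/4)"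
      using lam_pos by (simp add: powr_half_sqrt[symmetric] powr_powr)
    ultimately have "1 / sqrt q \<le> lam powr (-1/4)"
      using lam_pos by (simp add: powr_minus_divide frac_le)
    have "L2_norm (\<lambda>x. E a lam n x t) \<le> c * (1 / sqrt q)"
      using L2_norm_E_le[of t] by (simp add: c_def)
    also have "\<dots> \<le> (c + 1) * lam powr (-1/4)"
      using \<open>1 / sqrt q \<le> lam powr (-1/4)\<close> \<open>0 \<le> c\<close> q_pos by (intro mult_mono) auto
    finally show "L2_norm (\<lambda>x. E a lam n x t) \<le> (c + 1) * lam powr (-1/4)" .
  qed
  then show ?thesis
    using b1 \<open>0 \<le> c\<close> by (intro exI[of _ "c + 1"] exI[of _ "b\<^sup>2"]) auto
qed

end
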